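(* A fourth-order linear equation in standard form $$y^{(4)}+c_3(x)\,y^{(3)}+c_2(x)\,y''+c_1(x)\,y'+c_0(x)\,y=0$$ has a maximal symmetry algebra if and only if its coefficients satisfy the two equations $$8c_1=4c_2c_3-c_3^3+8c_2'-6c_3c_3'-4c_3'',$$ $$1600\,c_0=144c_2^2-11c_3^4+400c_3c_2'-288c_3^2c_3'-336(c_3')^2-8c_2(c_3^2+4c_3')+480c_2''-560c_3c_3''-320c_3^{(3)}.$$
   Context: All coefficients $c_j=c_j(x)$ are smooth functions on an open interval; primes denote derivatives with respect to $x$. The symmetry algebra of an ordinary differential equation is the Lie algebra of its Lie point symmetries, i.e. vector fields $\xi(x,y)\partial_x+\eta(x,y)\partial_y$ satisfying the infinitesimal criterion of invariance for the equation. For a linear ordinary differential equation of order $n\ge 3$ the maximal possible dimension of this algebra is $n+4$ (so $8$ for $n=4$); the equation is said to have a maximal symmetry algebra if this dimension is attained. By known results of Lie and of Krause and Michel this is equivalent to the equation being reducible by a (local) invertible point transformation to $y^{(n)}=0$. *)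

theory Defs
  imports "HOL-Analysis.Analysis" "HOL-Library.Function_Algebras"
begin

primrec times_cont_differentiable_on ::
  "nat \<Rightarrow> ('a::real_normed_vector \<Rightarrow> 'b::real_normed_vector) \<Rightarrow> 'a set \<Rightarrow> bool" where
  "times_cont_differentiable_on 0 f S \<longleftrightarrow> continuous_on S f"
| "times_cont_differentiable_on (Suc k) f S \<longleftrightarrow>
     (\<forall>p\<in>S. f differentiable (at p)) \<and>
     (\<forall>v. times_cont_differentiable_on k (\<lambda>p. frechet_derivative f (at p) v) S)"

(* Intended for open S only, since the derivatives are taken in the full space. *)
definition smooth_on ::
  "('a::real_normed_vector \<Rightarrow> 'b::real_normed_vector) \<Rightarrow> 'a set \<Rightarrow> bool" where
  "smooth_on f S \<longleftrightarrow> (\<forall>k. times_cont_differentiable_on k f S)"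

(* A function on jet space: F x u, where u k is the jet coordinate y^(k), so u 0 = y.
   An ODE of order n is given as the zero set of such a function that depends only
   on x and u 0, ..., u n. *)
type_synonym jet_fun = "real \<Rightarrow> (nat \<Rightarrow> real) \<Rightarrow> real"

definition jet_dx :: "jet_fun \<Rightarrow> jet_fun" where
  "jet_dx F = (\<lambda>x u. deriv (\<lambda>t. F t u) x)"

definition jet_du :: "nat \<Rightarrow> jet_fun \<Rightarrow> jet_fun" where
  "jet_du k F = (\<lambda>x u. deriv (\<lambda>t. F x (u(k := t))) (u k))"

(* The total derivative D_x of a function F of x and u 0, ..., u m. *)
definition total_deriv :: "nat \<Rightarrow> jet_fun \<Rightarrow> jet_fun" where
  "total_deriv m F = (\<lambda>x u. jet_dx F x u + (\<Sum>k\<le>m. u (Suc k) * jet_du k F x u))"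

(* The vector field xi(x,y) d/dx + eta(x,y) d/dy, as the map (x,y) |-> (xi(x,y), eta(x,y)). *)
type_synonym vfield = "real \<times> real \<Rightarrow> real \<times> real"

definition vf_xi :: "vfield \<Rightarrow> jet_fun" where
  "vf_xi v = (\<lambda>x u. fst (v (x, u 0)))"

definition vf_eta :: "vfield \<Rightarrow> jet_fun" where
  "vf_eta v = (\<lambda>x u. snd (v (x, u 0)))"

(* The coefficient eta^(k) of d/dy^(k) in the prolongation of v:
   eta^(0) = eta,  eta^(k+1) = D_x eta^(k) - y^(k+1) D_x xi. *)
primrec prolong_coeff :: "vfield \<Rightarrow> nat \<Rightarrow> jet_fun" where
  "prolong_coeff v 0 = vf_eta v"
| "prolong_coeff v (Suc k) =
     (\<lambda>x u. total_deriv k (prolong_coeff v k) x u - u (Suc k) * total_deriv 0 (vf_xi v) x u)"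

definition prolong_apply :: "nat \<Rightarrow> vfield \<Rightarrow> jet_fun \<Rightarrow> jet_fun" where
  "prolong_apply n v F =
     (\<lambda>x u. vf_xi v x u * jet_dx F x u + (\<Sum>k\<le>n. prolong_coeff v k x u * jet_du k F x u))"

(* The infinitesimal criterion of invariance of the equation F = 0 of order n, x ranging over I. *)
definition infinitesimally_invariant :: "nat \<Rightarrow> real set \<Rightarrow> jet_fun \<Rightarrow> vfield \<Rightarrow> bool" where
  "infinitesimally_invariant n I F v \<longleftrightarrow>
     (\<forall>x\<in>I. \<forall>u. F x u = 0 \<longrightarrow> prolong_apply n v F x u = 0)"

(* Vector fields live on I \<times> UNIV. HOL functions are total, so they are normalised to 0
   outside; distinct elements are then distinct as vector fields on I \<times> UNIV, and the
   dimension below counts what it should. *)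
definition symmetry_algebra :: "nat \<Rightarrow> real set \<Rightarrow> jet_fun \<Rightarrow> vfield set" where
  "symmetry_algebra n I F =
     {v. smooth_on v (I \<times> UNIV) \<and> (\<forall>p. p \<notin> I \<times> UNIV \<longrightarrow> v p = 0) \<and>
         infinitesimally_invariant n I F v}"

definition vf_scale :: "real \<Rightarrow> vfield \<Rightarrow> vfield" where
  "vf_scale a v = (\<lambda>p. a *\<^sub>R v p)"

(* Addition of vector fields is the pointwise one of Function_Algebras. *)
interpretation vf: vector_space vf_scale
  by unfold_locales (auto simp: vf_scale_def fun_eq_iff algebra_simps)

(* n + 4 is the maximal possible dimension for linear equations of order n \<ge> 3.
   vf.dim is 0 on infinite-dimensional spaces, so the equation below includes finiteness. *)
definition has_maximal_symmetry_algebra :: "nat \<Rightarrow> real set \<Rightarrow> jet_fun \<Rightarrow> bool" where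
  "has_maximal_symmetry_algebra n I F \<longleftrightarrow> vf.dim (symmetry_algebra n I F) = n + 4"

end

theory Submission
  imports Defs
begin

text \<open>
Write \<open>p = (3 c3' + 3/4 c3\<^sup>2 - 2 c2) / 5\<close>, and let \<open>E1\<close>, \<open>E0\<close> be the differences of the two sides
of the two coefficient conditions.

Invariance is an identity in the jet coordinates \<open>u 0, ..., u 3\<close>, once \<open>u 4\<close> has been eliminated by the
equation. The coefficient of \<open>u 2 * u 3\<close> is \<open>-10 \<xi>\<^sub>y\<close>; once \<open>\<xi>\<^sub>y = 0\<close>, the coefficient of \<open>(u 2)\<^sup>2\<close> is
\<open>3 \<eta>\<^sub>y\<^sub>y\<close> (\<open>fiber_linearity\<close>). A symmetry therefore has the form \<open>\<xi>(x) d/dx + (\<phi>(x) y + \<psi>(x)) d/dy\<close>,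
and what remains are five linear equations in one variable (\<open>invariant_iff_determining\<close>): one says
that \<open>\<psi>\<close> solves the given equation, and the others, coming from the coefficients of \<open>u 3, ..., u 0\<close>, involve
\<open>\<xi>\<close> and \<open>\<phi>\<close>. The one from \<open>u 3\<close> expresses \<open>\<phi>'\<close> through \<open>\<xi>\<close>. Substituting it into the others turns
the one from \<open>u 2\<close> into the third-order equation \<open>\<xi>''' = p \<xi>' + p' \<xi> / 2\<close>, and, modulo this equation,
the last two into
\<open>3 E1 \<xi>' + E1' \<xi> = 0\<close> and \<open>E1 (300 \<xi>'' - 50 c3 \<xi>' - 50 c3' \<xi>) + 4 E0 \<xi>' + E0' \<xi> = 0\<close>
(\<open>determining_iff_reduced\<close>).

Fix a point \<open>x0\<close>. By uniqueness for linear equations a symmetry is determined by the eight numbers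
\<open>\<xi>, \<xi>', \<xi>'', \<phi>, \<psi>, \<psi>', \<psi>'', \<psi>'''\<close> at \<open>x0\<close>; hence the dimension is 8 exactly when these numbers can be
prescribed arbitrarily (\<open>dim_V_eq_8_iff\<close>). If they can, at every point, then a symmetry with
\<open>\<xi> = 0\<close>, \<open>\<xi>' = 1\<close>, \<open>\<xi>'' = 0\<close> at \<open>x0\<close> gives \<open>E1(x0) = 0\<close> and then \<open>E0(x0) = 0\<close> (\<open>defects_vanish\<close>).
Conversely, if \<open>E1\<close> and \<open>E0\<close> vanish identically, then only the equations for \<open>\<phi>'\<close>, \<open>\<xi>\<close> and \<open>\<psi>\<close> are left, and these are
solvable on the whole interval for all initial values (\<open>initial_data_surj\<close>).

Existence and uniqueness of global solutions is proved for first-order systems by the Picard series,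
whose terms are bounded by \<open>C (M \<bar>t - x0\<bar>)\<^sup>m / m!\<close> on every compact subinterval (\<open>iterate_bound\<close>);
the same bound gives uniqueness, since a solution vanishing at \<open>x0\<close> is its own iterate.
\<close>

section \<open>Calculus of smooth functions\<close>

lemma cont_diff_imp_has_derivative:
  assumes "times_cont_differentiable_on (Suc k) f S" "p \<in> S"
  shows "(f has_derivative frechet_derivative f (at p)) (at p)"
  using assms by (auto simp: frechet_derivative_works)

text \<open>
Derivatives are taken in the full space, so on an open set the notion depends only on the
values there. This allows the derivative of a function to be replaced by a formula valid on the set only.
\<close>

lemma cont_diff_cong:
  assumes "open S" "\<And>x. x \<in> S \<Longrightarrow> f x = g x" "times_cont_differentiable_on k f S"
  shows "times_cont_differentiable_on k g S"
  using assms(2,3)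
proof (induction k arbitrary: f g)
  case 0
  then show ?case using continuous_on_cong[of S S f g] by auto
next
  case (Suc k)
  have d: "(g has_derivative frechet_derivative f (at p)) (at p)" if "p \<in> S" for p
    using has_derivative_transform_within_open[OF cont_diff_imp_has_derivative[OF Suc.prems(2) that] \<open>open S\<close> that]
      Suc.prems(1) by blast
  then have "g differentiable (at p)" if "p \<in> S" for p
    using that by (auto simp: differentiable_def)
  moreover have "times_cont_differentiable_on k (\<lambda>p. frechet_derivative g (at p) v) S" for v
  proof (rule Suc.IH)
    show "frechet_derivative f (at p) v = frechet_derivative g (at p) v" if "p \<in> S" for p
      using frechet_derivative_at[OF d[OF that]] by simp
  qed (use Suc.prems in auto)
  ultimately show ?case by auto
qed

lemma cont_diff_SucI:
  assumes "open S" "\<And>p. p \<in> S \<Longrightarrow> (f has_derivative f' p) (at p)"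
    and "\<And>v. times_cont_differentiable_on k (\<lambda>p. f' p v) S"
  shows "times_cont_differentiable_on (Suc k) f S"
proof -
  have "times_cont_differentiable_on k (\<lambda>p. frechet_derivative f (at p) v) S" for v
    by (rule cont_diff_cong[OF \<open>open S\<close> _ assms(3)[of v]])
      (use frechet_derivative_at[OF assms(2)] in force)
  then show ?thesis
    using assms(2) by (auto simp: differentiable_def)
qed

lemma cont_diff_SucD: "times_cont_differentiable_on (Suc k) f S \<Longrightarrow> times_cont_differentiable_on k f S"
proof (induction k arbitrary: f)
  case 0
  then show ?case
    by (auto intro!: continuous_at_imp_continuous_on differentiable_imp_continuous_within)
qed auto

lemma cont_diff_const: "times_cont_differentiable_on k (\<lambda>_. c) S"
  by (induction k arbitrary: c) (auto simp: frechet_derivative_const)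

lemma cont_diff_bounded_linear:
  assumes "open S" "bounded_linear L"
  shows "times_cont_differentiable_on k L S"
proof (cases k)
  case 0
  then show ?thesis using assms(2) by (simp add: linear_continuous_on)
next
  case (Suc m)
  show ?thesis unfolding Suc
    by (rule cont_diff_SucI[OF \<open>open S\<close> bounded_linear_imp_has_derivative[OF assms(2)] cont_diff_const])
qed

lemma cont_diff_add:
  assumes "open S" "times_cont_differentiable_on k f S" "times_cont_differentiable_on k g S"
  shows "times_cont_differentiable_on k (\<lambda>x. f x + g x) S"
  using assms(2,3)
proof (induction k arbitrary: f g)
  case 0
  then show ?case by (auto intro: continuous_on_add)
next
  case (Suc k)
  show ?case
    by (rule cont_diff_SucI[OF \<open>open S\<close> has_derivative_add[OF cont_diff_imp_has_derivative[OF Suc.prems(1)] cont_diff_imp_has_derivative[OF Suc.prems(2)]]])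
      (use Suc in auto)
qed

lemma cont_diff_mult:
  fixes f g :: "'a::real_normed_vector \<Rightarrow> real"
  assumes "open S" "times_cont_differentiable_on k f S" "times_cont_differentiable_on k g S"
  shows "times_cont_differentiable_on k (\<lambda>x. f x * g x) S"
  using assms(2,3)
proof (induction k arbitrary: f g)
  case 0
  then show ?case by (auto intro: continuous_on_mult)
next
  case (Suc k)
  show ?case
  proof (rule cont_diff_SucI[OF \<open>open S\<close> has_derivative_mult[OF cont_diff_imp_has_derivative[OF Suc.prems(1)] cont_diff_imp_has_derivative[OF Suc.prems(2)]]])
    fix v
    show "times_cont_differentiable_on k (\<lambda>p. f p * frechet_derivative g (at p) v + frechet_derivative f (at p) v * g p) S"
      by (intro cont_diff_add \<open>open S\<close> Suc.IH cont_diff_SucD[OF Suc.prems(1)] cont_diff_SucD[OF Suc.prems(2)]) (use Suc.prems in auto)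
  qed
qed

lemma cont_diff_linear_comp:
  assumes "open S" "bounded_linear L" "times_cont_differentiable_on k f S"
  shows "times_cont_differentiable_on k (\<lambda>x. L (f x)) S"
  using assms(3)
proof (induction k arbitrary: f)
  case 0
  then show ?case using bounded_linear.continuous_on[OF assms(2)] by auto
next
  case (Suc k)
  show ?case
    by (rule cont_diff_SucI[OF \<open>open S\<close> bounded_linear.has_derivative[OF assms(2) cont_diff_imp_has_derivative[OF Suc.prems]]])
      (use Suc in auto)
qed

lemma cont_diff_comp_linear:
  assumes "open S" "bounded_linear L" "\<And>x. x \<in> S \<Longrightarrow> L x \<in> T" "times_cont_differentiable_on k f T"
  shows "times_cont_differentiable_on k (\<lambda>x. f (L x)) S"
  using assms(4)
proof (induction k arbitrary: f)
  case 0
  then show ?case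
    using continuous_on_compose2[of T f S L] linear_continuous_on[OF assms(2)] assms(3) by auto
next
  case (Suc k)
  show ?case
    by (rule cont_diff_SucI[OF \<open>open S\<close> has_derivative_compose[OF bounded_linear_imp_has_derivative[OF assms(2)] cont_diff_imp_has_derivative[OF Suc.prems assms(3)]]])
      (use Suc in auto)
qed

lemma cont_diff_Pair:
  assumes "open S" "times_cont_differentiable_on k f S" "times_cont_differentiable_on k g S"
  shows "times_cont_differentiable_on k (\<lambda>x. (f x, g x)) S"
  using assms(2,3)
proof (induction k arbitrary: f g)
  case 0
  then show ?case by (auto intro: continuous_on_Pair)
next
  case (Suc k)
  show ?case
    by (rule cont_diff_SucI[OF \<open>open S\<close> has_derivative_Pair[OF cont_diff_imp_has_derivative[OF Suc.prems(1)] cont_diff_imp_has_derivative[OF Suc.prems(2)]]])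
      (use Suc in auto)
qed

lemma smooth_on_cong:
  assumes "open S" "\<And>x. x \<in> S \<Longrightarrow> f x = g x" "smooth_on f S"
  shows "smooth_on g S"
  using cont_diff_cong[OF assms(1,2)] assms(3) by (auto simp: smooth_on_def)

lemma smooth_on_const: "smooth_on (\<lambda>_. c) S"
  by (simp add: smooth_on_def cont_diff_const)

lemma smooth_on_add: "open S \<Longrightarrow> smooth_on f S \<Longrightarrow> smooth_on g S \<Longrightarrow> smooth_on (\<lambda>x. f x + g x) S"
  by (simp add: smooth_on_def cont_diff_add)

lemma smooth_on_mult:
  fixes f g :: "'a::real_normed_vector \<Rightarrow> real"
  shows "open S \<Longrightarrow> smooth_on f S \<Longrightarrow> smooth_on g S \<Longrightarrow> smooth_on (\<lambda>x. f x * g x) S"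
  by (simp add: smooth_on_def cont_diff_mult)

lemma smooth_on_Pair: "open S \<Longrightarrow> smooth_on f S \<Longrightarrow> smooth_on g S \<Longrightarrow> smooth_on (\<lambda>x. (f x, g x)) S"
  by (simp add: smooth_on_def cont_diff_Pair)

lemma smooth_on_linear_comp: "open S \<Longrightarrow> bounded_linear L \<Longrightarrow> smooth_on f S \<Longrightarrow> smooth_on (\<lambda>x. L (f x)) S"
  by (simp add: smooth_on_def cont_diff_linear_comp)

lemma smooth_on_comp_linear:
  assumes "open S" "bounded_linear L" "\<And>x. x \<in> S \<Longrightarrow> L x \<in> T" "smooth_on f T"
  shows "smooth_on (\<lambda>x. f (L x)) S"
  unfolding smooth_on_def
  using cont_diff_comp_linear[OF assms(1-3)] assms(4)[unfolded smooth_on_def] by blast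

lemma smooth_on_bounded_linear: "open S \<Longrightarrow> bounded_linear L \<Longrightarrow> smooth_on L S"
  by (simp add: smooth_on_def cont_diff_bounded_linear)

lemma smooth_on_minus:
  fixes f g :: "'a::real_normed_vector \<Rightarrow> real"
  assumes "open S" "smooth_on f S" "smooth_on g S"
  shows "smooth_on (\<lambda>x. f x - g x) S"
  using smooth_on_add[OF assms(1,2) smooth_on_linear_comp[OF assms(1) _ assms(3), of uminus]]
  by (simp add: bounded_linear_minus)

lemma smooth_on_has_derivative:
  assumes "smooth_on f S" "p \<in> S"
  shows "(f has_derivative frechet_derivative f (at p)) (at p)"
  using assms cont_diff_imp_has_derivative[of 0] unfolding smooth_on_def by blast

lemma smooth_on_frechet_derivative:
  "smooth_on f S \<Longrightarrow> smooth_on (\<lambda>p. frechet_derivative f (at p) v) S"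
  unfolding smooth_on_def using times_cont_differentiable_on.simps(2)[of _ f S] by blast

lemma smooth_on_has_real_derivative:
  fixes f :: "real \<Rightarrow> real"
  assumes "smooth_on f S" "x \<in> S"
  shows "(f has_real_derivative deriv f x) (at x)"
  using smooth_on_has_derivative[OF assms]
  by (metis DERIV_imp_deriv differentiable_def real_differentiable_def)

lemma smooth_on_deriv:
  fixes f :: "real \<Rightarrow> real"
  assumes "open S" "smooth_on f S"
  shows "smooth_on (deriv f) S"
proof (rule smooth_on_cong[OF \<open>open S\<close> _ smooth_on_frechet_derivative[OF assms(2), of 1]])
  fix x assume "x \<in> S"
  from smooth_on_has_real_derivative[OF assms(2) this] show "frechet_derivative f (at x) 1 = deriv f x"
    by (metis frechet_derivative_at has_field_derivative_def mult.right_neutral)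
qed

lemma smooth_on_higher_deriv:
  fixes f :: "real \<Rightarrow> real"
  assumes "open S" "smooth_on f S"
  shows "smooth_on ((deriv ^^ k) f) S"
  by (induction k) (use assms smooth_on_deriv in auto)

lemma cont_diff_real_SucI:
  fixes f :: "real \<Rightarrow> real"
  assumes "open S" "\<And>x. x \<in> S \<Longrightarrow> (f has_real_derivative f' x) (at x)"
    and "times_cont_differentiable_on k f' S"
  shows "times_cont_differentiable_on (Suc k) f S"
  by (rule cont_diff_SucI[OF assms(1) assms(2)[unfolded has_field_derivative_def]])
    (auto intro: cont_diff_mult[OF assms(1,3) cont_diff_const])

lemma deriv_eqI:
  fixes f g :: "real \<Rightarrow> real"
  assumes "open S" "\<And>x. x \<in> S \<Longrightarrow> f x = g x" "x \<in> S"
  shows "deriv f x = deriv g x"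
  by (rule deriv_cong_ev) (use assms eventually_nhds[of "\<lambda>x. f x = g x" x] in auto)

section \<open>Linear ordinary differential equations on an interval\<close>

definition antideriv_from :: "real \<Rightarrow> (real \<Rightarrow> real) \<Rightarrow> real \<Rightarrow> real" where
  "antideriv_from x0 f t = (if x0 \<le> t then integral {x0..t} f else - integral {t..x0} f)"

lemma open_interval_around:
  fixes I :: "real set"
  assumes "open I" "is_interval I" "s \<in> I" "t \<in> I"
  obtains l r where "l < s" "l < t" "s < r" "t < r" "{l..r} \<subseteq> I"
proof -
  have "min s t \<in> I" "max s t \<in> I"
    using assms(3,4) by (simp_all add: min_def max_def)
  then obtain d e where d: "0 < d" "cball (min s t) d \<subseteq> I" and e: "0 < e" "cball (max s t) e \<subseteq> I"
    using \<open>open I\<close> open_contains_cball by metis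
  define l r where "l = min s t - d" and "r = max s t + e"
  have "l \<in> I" "r \<in> I"
    using d e subsetD[OF d(2), of l] subsetD[OF e(2), of r] unfolding l_def r_def
    by (simp_all add: dist_real_def)
  moreover have "l < min s t" "max s t < r"
    using d(1) e(1) by (simp_all only: l_def r_def diff_less_eq less_add_same_cancel1)
  ultimately have l: "l < min s t" "l \<in> I" and r: "max s t < r" "r \<in> I"
    by blast+
  have "{l..r} \<subseteq> I"
    using mem_is_interval_1_I[OF assms(2) l(2) r(2)] by auto
  moreover have "l < s" "l < t" "s < r" "t < r"
    using l(1) r(1) by (simp_all only: min_less_iff_conj max_less_iff_conj)
  ultimately show ?thesis using that[of l r] by blast
qed

lemma antideriv_from_has_derivative:
  assumes "open I" "is_interval I" "x0 \<in> I" "continuous_on I f" "t \<in> I"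
  shows "(antideriv_from x0 f has_real_derivative f t) (at t)"
proof -
  obtain l r where lr: "l < x0" "l < t" "x0 < r" "t < r" "{l..r} \<subseteq> I"
    using open_interval_around assms(1,2,3,5) by metis
  have cont: "continuous_on {l..r} f"
    using continuous_on_subset[OF assms(4) lr(5)] .
  have "((\<lambda>u. integral {l..u} f) has_vector_derivative f t) (at t within {l..r})"
    by (rule integral_has_vector_derivative[OF cont]) (use lr in auto)
  then have "((\<lambda>u. integral {l..u} f) has_real_derivative f t) (at t)"
    using lr at_within_interior[of t "{l..r}"] by (simp add: has_real_derivative_iff_has_vector_derivative)
  then have "((\<lambda>u. integral {l..u} f - integral {l..x0} f) has_real_derivative f t) (at t)"
    by (auto intro!: derivative_eq_intros)
  moreover have "integral {l..u} f - integral {l..x0} f = antideriv_from x0 f u" if "u \<in> {l<..<r}" for u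
  proof -
    have int: "f integrable_on {l..v}" if "v \<le> r" for v
      by (rule integrable_continuous_real) (use cont that in \<open>auto intro: continuous_on_subset\<close>)
    show ?thesis
      using Henstock_Kurzweil_Integration.integral_combine[of l x0 u f] Henstock_Kurzweil_Integration.integral_combine[of l u x0 f] int[of u] int[of x0] that lr
      by (auto simp: antideriv_from_def)
  qed
  ultimately show ?thesis
    using has_field_derivative_transform_within_open[of "\<lambda>u. integral {l..u} f - integral {l..x0} f" "f t" t "{l<..<r}"] lr
    by auto
qed

lemma antideriv_from_base: "antideriv_from x0 f x0 = 0"
  by (simp add: antideriv_from_def)

text \<open>
Parametrising the segment from \<open>x0\<close> to \<open>t\<close> by \<open>[0, 1]\<close> treats both sides of \<open>x0\<close> at once. Integrating the
bound once raises the exponent and divides by it; iterated, this produces the factorials that make the Picard series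
converge on all of the interval.
\<close>

lemma antiderivative_power_bound:
  fixes F f :: "real \<Rightarrow> real"
  assumes der: "\<And>x. x \<in> closed_segment x0 t \<Longrightarrow> (F has_real_derivative f x) (at x)"
    and bnd: "\<And>x. x \<in> closed_segment x0 t \<Longrightarrow> \<bar>f x\<bar> \<le> K * \<bar>x - x0\<bar> ^ n"
    and "F x0 = 0"
  shows "\<bar>F t\<bar> \<le> K * \<bar>t - x0\<bar> ^ Suc n / real (Suc n)"
proof -
  define p where "p s = x0 + s * (t - x0)" for s
  have p: "p s \<in> closed_segment x0 t" if "0 \<le> s" "s \<le> 1" for s
    using that by (auto simp: closed_segment_def p_def algebra_simps intro!: exI[of _ s])
  have dF: "((\<lambda>s. F (p s)) has_vector_derivative (f (p s) * (t - x0))) (at s)" if "0 \<le> s" "s \<le> 1" for s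
    unfolding has_real_derivative_iff_has_vector_derivative[symmetric]
    by (rule DERIV_chain2[where f = F and g = p, OF der[OF p[OF that]]])
      (auto simp: p_def[abs_def] intro!: derivative_eq_intros)
  let ?\<phi> = "\<lambda>s. K * \<bar>t - x0\<bar> ^ Suc n * s ^ Suc n / real (Suc n)"
  have d\<phi>: "(?\<phi> has_vector_derivative K * \<bar>t - x0\<bar> ^ Suc n * s ^ n) (at s)" for s
    unfolding has_real_derivative_iff_has_vector_derivative[symmetric]
    by (rule derivative_eq_intros refl | simp)+
  have "norm (F (p 1) - F (p 0)) \<le> ?\<phi> 1 - ?\<phi> 0"
  proof (rule differentiable_bound_general[OF _ _ _ dF d\<phi>])
    show "continuous_on {0..1} (\<lambda>s. F (p s))"
      by (intro continuous_at_imp_continuous_on ballI has_vector_derivative_continuous[OF dF]) auto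
    show "continuous_on {0..1} ?\<phi>"
      by (intro continuous_at_imp_continuous_on ballI has_vector_derivative_continuous[OF d\<phi>])
    fix s :: real assume s: "0 < s" "s < 1"
    then have "\<bar>f (p s)\<bar> \<le> K * (s * \<bar>t - x0\<bar>) ^ n"
      using bnd[OF p[of s]] by (simp add: p_def abs_mult)
    then have "\<bar>f (p s)\<bar> * \<bar>t - x0\<bar> \<le> K * (s * \<bar>t - x0\<bar>) ^ n * \<bar>t - x0\<bar>"
      by (rule mult_right_mono) simp
    then show "norm (f (p s) * (t - x0)) \<le> K * \<bar>t - x0\<bar> ^ Suc n * s ^ n"
      by (simp add: abs_mult power_mult_distrib mult_ac)
  qed auto
  then show ?thesis using \<open>F x0 = 0\<close> by (simp add: p_def)
qed

locale linear_system =
  fixes n :: nat and a :: "nat \<Rightarrow> nat \<Rightarrow> real \<Rightarrow> real" and I :: "real set" and x0 :: real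
  assumes open_I: "open I" and interval_I: "is_interval I" and x0: "x0 \<in> I"
    and continuous_a: "\<And>i j. i < n \<Longrightarrow> j < n \<Longrightarrow> continuous_on I (a i j)"
begin

definition is_solution :: "(nat \<Rightarrow> real \<Rightarrow> real) \<Rightarrow> bool" where
  "is_solution Y \<longleftrightarrow>
     (\<forall>i<n. \<forall>t\<in>I. (Y i has_real_derivative (\<Sum>j<n. a i j t * Y j t)) (at t))"

lemma coefficient_bound:
  assumes "{l..r} \<subseteq> I"
  obtains M where "0 \<le> M" "\<And>i t. i < n \<Longrightarrow> t \<in> {l..r} \<Longrightarrow> (\<Sum>j<n. \<bar>a i j t\<bar>) \<le> M"
proof -
  have "\<exists>B. \<forall>t\<in>{l..r}. (\<Sum>j<n. \<bar>a i j t\<bar>) \<le> B" if "i < n" for i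
  proof -
    have "continuous_on {l..r} (\<lambda>t. \<Sum>j<n. \<bar>a i j t\<bar>)"
      by (intro continuous_intros continuous_on_subset[OF continuous_a assms]) (use that in auto)
    then have "bounded ((\<lambda>t. \<Sum>j<n. \<bar>a i j t\<bar>) ` {l..r})"
      by (intro compact_imp_bounded compact_continuous_image) auto
    then show ?thesis unfolding bounded_iff by (auto dest: abs_le_D1)
  qed
  then obtain B where B: "\<And>i t. i < n \<Longrightarrow> t \<in> {l..r} \<Longrightarrow> (\<Sum>j<n. \<bar>a i j t\<bar>) \<le> B i"
    by metis
  have "(\<Sum>j<n. \<bar>a i j t\<bar>) \<le> (\<Sum>i<n. \<bar>B i\<bar>)" if "i < n" "t \<in> {l..r}" for i t
    using B[OF that] member_le_sum[of i "{..<n}" "\<lambda>i. \<bar>B i\<bar>"] that by force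
  then show ?thesis using that[of "\<Sum>i<n. \<bar>B i\<bar>"] by (simp add: sum_nonneg)
qed

text \<open>
One integration step, used twice: for the Picard iterates, with \<open>F\<close> the next iterate of \<open>Z\<close>, and for
uniqueness, with \<open>Z\<close> a solution and \<open>F\<close> one of its own components.
\<close>

lemma iterate_bound:
  assumes M: "\<And>i t. i < n \<Longrightarrow> t \<in> {l..r} \<Longrightarrow> (\<Sum>j<n. \<bar>a i j t\<bar>) \<le> M" "0 \<le> M"
    and lr: "x0 \<in> {l..r}" "t \<in> {l..r}" and "0 \<le> C" and "i < n"
    and der: "\<And>t. t \<in> {l..r} \<Longrightarrow> (F has_real_derivative (\<Sum>j<n. a i j t * Z j t)) (at t)"
    and "F x0 = 0"
    and Z: "\<And>j t. j < n \<Longrightarrow> t \<in> {l..r} \<Longrightarrow> \<bar>Z j t\<bar> \<le> C * M ^ m * \<bar>t - x0\<bar> ^ m / fact m"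
  shows "\<bar>F t\<bar> \<le> C * M ^ Suc m * \<bar>t - x0\<bar> ^ Suc m / fact (Suc m)"
proof -
  have seg: "closed_segment x0 t \<subseteq> {l..r}"
    using lr by (auto simp: closed_segment_eq_real_ivl split: if_splits)
  have "\<bar>F t\<bar> \<le> (C * M ^ Suc m / fact m) * \<bar>t - x0\<bar> ^ Suc m / real (Suc m)"
  proof (rule antiderivative_power_bound)
    fix x assume "x \<in> closed_segment x0 t"
    then have x: "x \<in> {l..r}" using seg by auto
    show "(F has_real_derivative (\<Sum>j<n. a i j x * Z j x)) (at x)" using der[OF x] .
    let ?K = "C * M ^ m * \<bar>x - x0\<bar> ^ m / fact m"
    have "0 \<le> ?K" using \<open>0 \<le> C\<close> \<open>0 \<le> M\<close> by simp
    have "\<bar>\<Sum>j<n. a i j x * Z j x\<bar> \<le> (\<Sum>j<n. \<bar>a i j x\<bar> * \<bar>Z j x\<bar>)"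
      using sum_abs[of "\<lambda>j. a i j x * Z j x" "{..<n}"] by (simp add: abs_mult)
    also have "\<dots> \<le> (\<Sum>j<n. \<bar>a i j x\<bar> * ?K)"
      by (intro sum_mono mult_left_mono Z x) auto
    also have "\<dots> \<le> M * ?K"
      using mult_right_mono[OF M(1)[OF \<open>i < n\<close> x] \<open>0 \<le> ?K\<close>]
      by (simp only: sum_distrib_right)
    finally show "\<bar>\<Sum>j<n. a i j x * Z j x\<bar> \<le> (C * M ^ Suc m / fact m) * \<bar>x - x0\<bar> ^ m"
      by (simp add: mult_ac)
  qed fact
  then show ?thesis by (simp add: mult_ac)
qed

lemma solution_unique:
  assumes Y: "is_solution Y" and Y0: "\<And>i. i < n \<Longrightarrow> Y i x0 = 0" and "i < n" "t \<in> I"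
  shows "Y i t = 0"
proof -
  obtain l r where lr: "l < x0" "l < t" "x0 < r" "t < r" "{l..r} \<subseteq> I"
    using open_interval_around open_I interval_I x0 \<open>t \<in> I\<close> by metis
  obtain M where M: "0 \<le> M" "\<And>i t. i < n \<Longrightarrow> t \<in> {l..r} \<Longrightarrow> (\<Sum>j<n. \<bar>a i j t\<bar>) \<le> M"
    using coefficient_bound[OF lr(5)] by blast
  have der: "(Y i has_real_derivative (\<Sum>j<n. a i j t * Y j t)) (at t)" if "i < n" "t \<in> {l..r}" for i t
    using Y that lr(5) by (auto simp: is_solution_def)
  have "\<exists>C. \<forall>t\<in>{l..r}. \<bar>Y i t\<bar> \<le> C" if "i < n" for i
  proof -
    have "continuous_on {l..r} (Y i)"
      by (intro continuous_at_imp_continuous_on ballI DERIV_isCont[OF der[OF that]])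
    then have "bounded (Y i ` {l..r})"
      by (intro compact_imp_bounded compact_continuous_image) auto
    then show ?thesis unfolding bounded_iff by auto
  qed
  then obtain C where C: "\<And>i t. i < n \<Longrightarrow> t \<in> {l..r} \<Longrightarrow> \<bar>Y i t\<bar> \<le> C i" by metis
  define D where "D = (\<Sum>i<n. \<bar>C i\<bar>)"
  have "0 \<le> D" by (simp add: D_def sum_nonneg)
  have D: "\<bar>Y i t\<bar> \<le> D" if "i < n" "t \<in> {l..r}" for i t
    using C[OF that] member_le_sum[of i "{..<n}" "\<lambda>i. \<bar>C i\<bar>"] that by (force simp: D_def)
  have bound: "\<bar>Y i t\<bar> \<le> D * M ^ m * \<bar>t - x0\<bar> ^ m / fact m" if "i < n" "t \<in> {l..r}" for m i t
    using that
  proof (induction m arbitrary: i t)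
    case 0
    then show ?case using D by simp
  next
    case (Suc m)
    show ?case
      by (rule iterate_bound[OF M(2,1) _ Suc.prems(2) \<open>0 \<le> D\<close> Suc.prems(1) der[OF Suc.prems(1)] Y0[OF Suc.prems(1)] Suc.IH])
        (use lr in auto)
  qed
  have "(\<lambda>m. D * ((M * \<bar>t - x0\<bar>) ^ m / fact m)) \<longlonglongrightarrow> D * 0"
    by (intro tendsto_mult_left summable_LIMSEQ_zero) (use summable_exp[of "M * \<bar>t - x0\<bar>"] in \<open>simp add: divide_inverse mult_ac\<close>)
  then have "\<bar>Y i t\<bar> \<le> D * 0"
    by (rule tendsto_lowerbound) (use bound[OF \<open>i < n\<close>, of t] lr in \<open>auto simp: power_mult_distrib mult_ac\<close>)
  then show ?thesis by simp
qed

primrec picard :: "(nat \<Rightarrow> real) \<Rightarrow> nat \<Rightarrow> nat \<Rightarrow> real \<Rightarrow> real" where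
  "picard b 0 = (\<lambda>i _. b i)"
| "picard b (Suc m) = (\<lambda>i. antideriv_from x0 (\<lambda>t. \<Sum>j<n. a i j t * picard b m j t))"

lemma continuous_picard: "i < n \<Longrightarrow> continuous_on I (picard b m i)"
  and picard_Suc_has_derivative: "i < n \<Longrightarrow> t \<in> I \<Longrightarrow>
    (picard b (Suc m) i has_real_derivative (\<Sum>j<n. a i j t * picard b m j t)) (at t)"
proof -
  have step: "(picard b (Suc m) i has_real_derivative (\<Sum>j<n. a i j t * picard b m j t)) (at t)"
    if "\<And>j. j < n \<Longrightarrow> continuous_on I (picard b m j)" "i < n" "t \<in> I" for m i t
  proof -
    have "continuous_on I (\<lambda>t. \<Sum>j<n. a i j t * picard b m j t)"
      by (intro continuous_intros continuous_a that) (use that in auto)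
    from antideriv_from_has_derivative[OF open_I interval_I x0 this \<open>t \<in> I\<close>]
    show ?thesis by simp
  qed
  have cont: "continuous_on I (picard b m i)" if "i < n" for m i
    using that
  proof (induction m arbitrary: i)
    case (Suc m)
    show ?case
      by (intro continuous_at_imp_continuous_on ballI DERIV_isCont[OF step[OF Suc.IH]])
        (use Suc.prems in auto)
  qed auto
  show "i < n \<Longrightarrow> continuous_on I (picard b m i)" by (rule cont)
  show "i < n \<Longrightarrow> t \<in> I \<Longrightarrow>
    (picard b (Suc m) i has_real_derivative (\<Sum>j<n. a i j t * picard b m j t)) (at t)"
    by (rule step[OF cont])
qed

text \<open>
Each Picard iterate is an integral over a segment inside \<open>I\<close>, so the series makes sense on the whole of \<open>I\<close>;
compact subintervals enter only for the uniform bounds behind its termwise derivative.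
\<close>

lemma solution_exists:
  obtains Y where "is_solution Y" "\<And>i. i < n \<Longrightarrow> Y i x0 = b i"
proof
  define Y where "Y i t = (\<Sum>m. picard b m i t)" for i t
  show "is_solution Y"
    unfolding is_solution_def
  proof (intro allI impI ballI)
    fix i t assume i: "i < n" and t: "t \<in> I"
    obtain l r where lr: "l < x0" "l < t" "x0 < r" "t < r" "{l..r} \<subseteq> I"
      using open_interval_around open_I interval_I x0 \<open>t \<in> I\<close> by metis
    obtain M where M: "0 \<le> M" "\<And>i t. i < n \<Longrightarrow> t \<in> {l..r} \<Longrightarrow> (\<Sum>j<n. \<bar>a i j t\<bar>) \<le> M"
      using coefficient_bound[OF lr(5)] by blast
    define D where "D = (\<Sum>i<n. \<bar>b i\<bar>)"
    have "0 \<le> D" by (simp add: D_def sum_nonneg)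
    have bound: "\<bar>picard b m i t\<bar> \<le> D * M ^ m * \<bar>t - x0\<bar> ^ m / fact m" if "i < n" "t \<in> {l..r}" for m i t
      using that
    proof (induction m arbitrary: i t)
      case 0
      then show ?case using member_le_sum[of i "{..<n}" "\<lambda>i. \<bar>b i\<bar>"] by (simp add: D_def)
    next
      case (Suc m)
      show ?case
        by (rule iterate_bound[OF M(2,1) _ Suc.prems(2) \<open>0 \<le> D\<close> Suc.prems(1) _ _ Suc.IH])
          (use lr Suc.prems picard_Suc_has_derivative in \<open>auto simp: antideriv_from_base\<close>)
    qed
    define L where "L = r - l"
    define B where "B m = D * ((M * L) ^ m / fact m)" for m
    have B: "\<bar>picard b m i t\<bar> \<le> B m" if "i < n" "t \<in> {l..r}" for m i t
    proof -
      have "\<bar>t - x0\<bar> \<le> L" using that lr by (auto simp: L_def)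
      then have "D * M ^ m * \<bar>t - x0\<bar> ^ m / fact m \<le> D * M ^ m * L ^ m / fact m"
        using \<open>0 \<le> D\<close> M(1) by (intro divide_right_mono mult_left_mono power_mono) auto
      then show ?thesis using bound[OF that, of m] by (simp add: B_def power_mult_distrib mult_ac)
    qed
    have "summable B"
      unfolding B_def using summable_exp[of "M * L"]
      by (intro summable_mult) (simp add: divide_inverse mult_ac)
    have summ: "summable (\<lambda>m. picard b m i t)" if "i < n" "t \<in> {l..r}" for i t
      by (rule summable_comparison_test'[OF \<open>summable B\<close>, of 0]) (use B[OF that] in auto)
    \<comment> \<open>The initial term of the series is constant, so the differentiated series is shifted by one index.\<close>
    define f' where "f' m t = (case m of 0 \<Rightarrow> 0 | Suc k \<Rightarrow> \<Sum>j<n. a i j t * picard b k j t)" for m t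
    have der: "(picard b m i has_real_derivative f' m t) (at t within {l..r})" if "t \<in> {l..r}" for m t
    proof (cases m)
      case (Suc k)
      then show ?thesis
        using DERIV_subset[OF picard_Suc_has_derivative[OF i, of t b k] subset_UNIV] that lr(5)
        by (auto simp: f'_def)
    qed (simp add: f'_def)
    have bnd': "norm (f' m t) \<le> (case m of 0 \<Rightarrow> 0 | Suc k \<Rightarrow> M * B k)" if t: "t \<in> {l..r}" for m t
    proof (cases m)
      case (Suc k)
      have "0 \<le> B k" using B[OF i t, of k] by linarith
      have "\<bar>\<Sum>j<n. a i j t * picard b k j t\<bar> \<le> (\<Sum>j<n. \<bar>a i j t\<bar> * \<bar>picard b k j t\<bar>)"
        using sum_abs[of "\<lambda>j. a i j t * picard b k j t" "{..<n}"] by (simp add: abs_mult)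
      also have "\<dots> \<le> (\<Sum>j<n. \<bar>a i j t\<bar> * B k)"
        by (intro sum_mono mult_left_mono B t) auto
      also have "\<dots> \<le> M * B k"
        using mult_right_mono[OF M(2)[OF i t] \<open>0 \<le> B k\<close>] by (simp add: sum_distrib_right)
      finally show ?thesis by (simp add: Suc f'_def)
    qed (simp add: f'_def)
    have "summable (\<lambda>m. case m of 0 \<Rightarrow> 0 | Suc k \<Rightarrow> M * B k)"
      by (subst summable_Suc_iff[symmetric])
        (use summable_mult[OF \<open>summable B\<close>, of M] in \<open>simp only: nat.case\<close>)
    then have "uniformly_convergent_on {l..r} (\<lambda>k x. \<Sum>i<k. f' i x)"
      using Weierstrass_m_test'[where A = "{l..r}" and f = f', OF bnd'] by blast
    from has_field_derivative_series'(2)[OF convex_real_interval(5) der this _ summ[OF i], of x0 t] lr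
    have "(Y i has_real_derivative (\<Sum>m. f' m t)) (at t)"
      by (auto simp: Y_def[abs_def])
    moreover have "(\<lambda>m. f' m t) sums (\<Sum>j<n. a i j t * Y j t)"
    proof (rule sums_Suc_imp)
      show "(\<lambda>m. f' (Suc m) t) sums (\<Sum>j<n. a i j t * Y j t)"
        unfolding f'_def Y_def nat.case
        by (intro sums_sum sums_mult summable_sums summ) (use lr in auto)
    qed (simp add: f'_def)
    ultimately show "(Y i has_real_derivative (\<Sum>j<n. a i j t * Y j t)) (at t)"
      by (simp add: sums_iff)
  qed
  show "Y i x0 = b i" if "i < n" for i
  proof -
    have "picard b m i x0 = 0" if "m \<noteq> 0" for m
      using that by (cases m) (auto simp: antideriv_from_base)
    then have "(\<Sum>m. picard b m i x0) = (\<Sum>m\<in>{0}. picard b m i x0)"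
      by (intro suminf_finite) auto
    then show ?thesis by (simp add: Y_def)
  qed
qed

text \<open>
The right-hand side of the system is as smooth as the solution, so each use of the
system gains one derivative; the induction has to run over all components simultaneously.
\<close>

lemma solution_smooth:
  assumes "\<And>i j. i < n \<Longrightarrow> j < n \<Longrightarrow> smooth_on (a i j) I" and Y: "is_solution Y" and "i < n"
  shows "smooth_on (Y i) I"
proof -
  have der: "(Y i has_real_derivative (\<Sum>j<n. a i j t * Y j t)) (at t)" if "i < n" "t \<in> I" for i t
    using Y that by (auto simp: is_solution_def)
  have "times_cont_differentiable_on k (Y i) I" if "i < n" for k i
    using that
  proof (induction k arbitrary: i)
    case 0
    then show ?case
      by (auto intro!: continuous_at_imp_continuous_on DERIV_isCont[OF der])
  next
    case (Suc k)
    have "times_cont_differentiable_on k (\<lambda>t. \<Sum>j\<in>J. a i j t * Y j t) I" if "J \<subseteq> {..<n}" for J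
      using finite_subset[OF that finite_lessThan] that
    proof (induction J rule: finite_induct)
      case empty
      then show ?case by (simp add: cont_diff_const)
    next
      case (insert j J)
      have "times_cont_differentiable_on k (\<lambda>t. a i j t * Y j t) I"
        using insert.prems assms(1)[OF Suc.prems, of j] Suc.IH[of j]
        by (intro cont_diff_mult open_I) (auto simp: smooth_on_def)
      then show ?case using insert by (simp add: cont_diff_add[OF open_I])
    qed
    then show ?case
      by (intro cont_diff_real_SucI[OF open_I der[OF Suc.prems]]) auto
  qed
  then show ?thesis using \<open>i < n\<close> by (simp add: smooth_on_def)
qed

end


lemma higher_deriv_eq_component:
  fixes Y :: "nat \<Rightarrow> real \<Rightarrow> real"
  assumes "open I" "\<And>i t. Suc i < n \<Longrightarrow> t \<in> I \<Longrightarrow> (Y i has_real_derivative Y (Suc i) t) (at t)"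
    and "j < n" "t \<in> I"
  shows "(deriv ^^ j) (Y 0) t = Y j t"
  using assms(3,4)
proof (induction j arbitrary: t)
  case (Suc j)
  have "deriv ((deriv ^^ j) (Y 0)) t = deriv (Y j) t"
    by (rule deriv_eqI[OF \<open>open I\<close>]) (use Suc in auto)
  then show ?case
    using DERIV_imp_deriv[OF assms(2)[OF Suc.prems]] by simp
qed simp

text \<open>
The equation \<open>y\<^sup>(\<^sup>n\<^sup>) = a\<^sub>0 y + ... + a\<^sub>n\<^sub>-\<^sub>1 y\<^sup>(\<^sup>n\<^sup>-\<^sup>1\<^sup>)\<close> is the system with the companion matrix of the coefficients.
\<close>

locale linear_ode =
  fixes n :: nat and a :: "nat \<Rightarrow> real \<Rightarrow> real" and I :: "real set" and x0 :: real
  assumes n_pos: "0 < n" and open_I: "open I" and interval_I: "is_interval I" and x0: "x0 \<in> I"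
    and smooth_a: "\<And>j. j < n \<Longrightarrow> smooth_on (a j) I"
begin

definition companion :: "nat \<Rightarrow> nat \<Rightarrow> real \<Rightarrow> real" where
  "companion i j t = (if Suc i < n then (if j = Suc i then 1 else 0) else a j t)"

lemma smooth_companion: "j < n \<Longrightarrow> smooth_on (companion i j) I"
  unfolding companion_def[abs_def]
  by (cases "Suc i < n") (auto intro: smooth_a smooth_on_const)

sublocale linear_system n companion I x0
proof
  show "continuous_on I (companion i j)" if "j < n" for i j
    using smooth_companion[OF that] unfolding smooth_on_def
    by (metis times_cont_differentiable_on.simps(1))
qed (rule open_I interval_I x0)+

lemma sum_companion:
  assumes "i < n"
  shows "(\<Sum>j<n. companion i j t * Y j t) = (if Suc i < n then Y (Suc i) t else (\<Sum>j<n. a j t * Y j t))"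
proof (cases "Suc i < n")
  case True
  have "(\<Sum>j<n. companion i j t * Y j t) = (\<Sum>j<n. if j = Suc i then Y j t else 0)"
    using True by (intro sum.cong) (auto simp: companion_def)
  then show ?thesis using True by simp
qed (simp add: companion_def)

lemma ode_solution_exists:
  obtains y where "smooth_on y I"
    "\<And>t. t \<in> I \<Longrightarrow> (deriv ^^ n) y t = (\<Sum>j<n. a j t * (deriv ^^ j) y t)"
    "\<And>j. j < n \<Longrightarrow> (deriv ^^ j) y x0 = b j"
proof -
  obtain Y where Y: "is_solution Y" "\<And>i. i < n \<Longrightarrow> Y i x0 = b i"
    using solution_exists by blast
  have der: "(Y i has_real_derivative (if Suc i < n then Y (Suc i) t else (\<Sum>j<n. a j t * Y j t))) (at t)"
    if "i < n" "t \<in> I" for i t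
    unfolding sum_companion[OF that(1), of t Y, symmetric]
    using Y(1) that by (simp add: is_solution_def)
  have comp: "(deriv ^^ j) (Y 0) t = Y j t" if "j < n" "t \<in> I" for j t
  proof (rule higher_deriv_eq_component[OF open_I _ that])
    fix i t assume "Suc i < n" "t \<in> I"
    then show "(Y i has_real_derivative Y (Suc i) t) (at t)" using der[of i t] by simp
  qed
  obtain m where m: "n = Suc m" using n_pos by (cases n) auto
  show ?thesis
  proof
    show "smooth_on (Y 0) I"
      by (rule solution_smooth[OF smooth_companion Y(1) n_pos])
    show "(deriv ^^ n) (Y 0) t = (\<Sum>j<n. a j t * (deriv ^^ j) (Y 0) t)" if "t \<in> I" for t
    proof -
      have "(deriv ^^ n) (Y 0) t = deriv (Y m) t"
        unfolding m by (simp, rule deriv_eqI[OF open_I _ that]) (simp add: comp m)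
      also have "\<dots> = (\<Sum>j<n. a j t * Y j t)"
        using DERIV_imp_deriv[OF der[of m t]] that by (simp add: m)
      finally show ?thesis using comp that by simp
    qed
    show "(deriv ^^ j) (Y 0) x0 = b j" if "j < n" for j
      using comp[OF that x0] Y(2)[OF that] by simp
  qed
qed

lemma ode_solution_unique:
  assumes "smooth_on y I"
    and ode: "\<And>t. t \<in> I \<Longrightarrow> (deriv ^^ n) y t = (\<Sum>j<n. a j t * (deriv ^^ j) y t)"
    and "\<And>j. j < n \<Longrightarrow> (deriv ^^ j) y x0 = 0" and "t \<in> I"
  shows "y t = 0"
proof -
  have "is_solution (\<lambda>i. (deriv ^^ i) y)"
    unfolding is_solution_def
  proof (intro allI impI ballI)
    fix i t assume i: "i < n" and t: "t \<in> I"
    have "((deriv ^^ i) y has_real_derivative (deriv ^^ Suc i) y t) (at t)"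
      using smooth_on_has_real_derivative[OF smooth_on_higher_deriv[OF open_I assms(1)] t] by simp
    moreover have "(deriv ^^ Suc i) y t = (\<Sum>j<n. companion i j t * (deriv ^^ j) y t)"
      unfolding sum_companion[OF i, of t "\<lambda>j. (deriv ^^ j) y"]
      using i ode[OF t] by (cases "Suc i = n") auto
    ultimately show "((deriv ^^ i) y has_real_derivative (\<Sum>j<n. companion i j t * (deriv ^^ j) y t)) (at t)"
      by simp
  qed
  from solution_unique[OF this assms(3) n_pos \<open>t \<in> I\<close>] show ?thesis by simp
qed

end

section \<open>Dimension through an injective evaluation map\<close>

text \<open>
The map \<open>\<Phi>\<close> is linear on the subspace \<open>V\<close> only, since derivatives at a point are not additive on arbitrary
functions. It is therefore replaced by a globally linear map that agrees with it on a basis of \<open>V\<close>. Injectivity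
makes the basis finite, with at most \<open>DIM('c)\<close> elements.
\<close>

lemma dim_eq_iff_image_UNIV:
  fixes scale :: "real \<Rightarrow> 'b::ab_group_add \<Rightarrow> 'b" and \<Phi> :: "'b \<Rightarrow> 'c::euclidean_space"
  assumes vs: "vector_space scale"
    and sub: "module.subspace scale V"
    and add: "\<And>v w. v \<in> V \<Longrightarrow> w \<in> V \<Longrightarrow> \<Phi> (v + w) = \<Phi> v + \<Phi> w"
    and scale: "\<And>a v. v \<in> V \<Longrightarrow> \<Phi> (scale a v) = a *\<^sub>R \<Phi> v"
    and inj: "\<And>v. v \<in> V \<Longrightarrow> \<Phi> v = 0 \<Longrightarrow> v = 0"
  shows "vector_space.dim scale V = DIM('c) \<longleftrightarrow> \<Phi> ` V = UNIV"
proof -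
  interpret vs: vector_space scale by fact
  interpret p: vector_space_pair scale "scaleR :: real \<Rightarrow> 'c \<Rightarrow> 'c" by unfold_locales
  obtain B where B: "B \<subseteq> V" "vs.independent B" "V \<subseteq> vs.span B" "card B = vs.dim V"
    using vs.basis_exists by blast
  have V: "V = vs.span B"
    using B(1,3) vs.span_minimal[OF B(1) sub] by blast
  obtain g where g: "Vector_Spaces.linear scale scaleR g" "\<And>x. x \<in> B \<Longrightarrow> g x = \<Phi> x"
    using p.linear_independent_extend[OF B(2)] by metis
  interpret g: Vector_Spaces.linear scale scaleR g by fact
  \<comment> \<open>Membership is carried along because linearity of \<open>\<Phi>\<close> is only available inside \<open>V\<close>.\<close>
  have "v \<in> V \<and> g v = \<Phi> v" if "v \<in> vs.span B" for v
    using that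
  proof (induction rule: vs.span_induct_alt)
    case base
    have "\<Phi> 0 = \<Phi> 0 + \<Phi> 0"
      using add[of 0 0] vs.subspace_0[OF sub] by simp
    then show ?case using vs.subspace_0[OF sub] by (simp add: g.zero)
  next
    case (step c x y)
    then show ?case
      using B(1) add scale g(2) vs.subspace_add[OF sub] vs.subspace_scale[OF sub]
      by (auto simp: g.add g.scale)
  qed
  then have g\<Phi>: "g v = \<Phi> v" if "v \<in> V" for v
    using that V by blast
  have "inj_on g (vs.span B)"
    unfolding V[symmetric]
  proof (rule inj_onI)
    fix x y assume xy: "x \<in> V" "y \<in> V" "g x = g y"
    then have "x - y \<in> V" using vs.subspace_diff[OF sub] by blast
    moreover from this have "\<Phi> (x - y) = 0" using xy g\<Phi> g.diff by fastforce
    ultimately show "x = y" using inj by force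
  qed
  note inj_g = this
  then have ind: "independent (g ` B)"
    using g.independent_injective_image[OF B(2)] by (simp add: dependent_raw_def)
  have "inj_on g B"
    using inj_on_subset[OF inj_g vs.span_superset] .
  have "span (g ` B) = \<Phi> ` V"
    using g.span_image[of B] V g\<Phi> by (auto simp: span_raw_def)
  moreover have "dim (\<Phi> ` V) = vs.dim V"
    unfolding calculation[symmetric] using dim_span_eq_card_independent[OF ind] card_image[OF \<open>inj_on g B\<close>] B(4) by simp
  ultimately show ?thesis
    by (metis dim_eq_full span_span)
qed

section \<open>Total derivatives of jet functions\<close>

text \<open>
The total derivative as a relation that includes differentiability in each variable separately. In this form it
is a derivation, and the prolongation formula can be evaluated by structural rules. Jet functions are
compared over \<open>I\<close> only.
\<close>

definition has_total_deriv :: "nat \<Rightarrow> real set \<Rightarrow> jet_fun \<Rightarrow> jet_fun \<Rightarrow> bool" where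
  "has_total_deriv m I F F' \<longleftrightarrow> (\<forall>x\<in>I. \<forall>u. \<exists>d e.
     ((\<lambda>t. F t u) has_real_derivative d) (at x) \<and>
     (\<forall>k\<le>m. ((\<lambda>t. F x (u(k := t))) has_real_derivative e k) (at (u k))) \<and>
     F' x u = d + (\<Sum>k\<le>m. u (Suc k) * e k))"

lemma has_total_derivE:
  assumes "has_total_deriv m I F F'" "x \<in> I"
  obtains d e where "((\<lambda>t. F t u) has_real_derivative d) (at x)"
    "\<And>k. k \<le> m \<Longrightarrow> ((\<lambda>t. F x (u(k := t))) has_real_derivative e k) (at (u k))"
    "F' x u = d + (\<Sum>k\<le>m. u (Suc k) * e k)"
proof -
  from assms(1)[unfolded has_total_deriv_def, rule_format, OF assms(2), of u]
  obtain d e where "((\<lambda>t. F t u) has_real_derivative d) (at x) \<and>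
     (\<forall>k\<le>m. ((\<lambda>t. F x (u(k := t))) has_real_derivative e k) (at (u k))) \<and>
     F' x u = d + (\<Sum>k\<le>m. u (Suc k) * e k)"
    by (elim exE)
  then show ?thesis by (intro that[of d e]) simp_all
qed

lemma has_total_derivI:
  assumes "\<And>x u. x \<in> I \<Longrightarrow> ((\<lambda>t. F t u) has_real_derivative d x u) (at x)"
    and "\<And>x u k. x \<in> I \<Longrightarrow> k \<le> m \<Longrightarrow> ((\<lambda>t. F x (u(k := t))) has_real_derivative e x u k) (at (u k))"
    and "\<And>x u. x \<in> I \<Longrightarrow> F' x u = d x u + (\<Sum>k\<le>m. u (Suc k) * e x u k)"
  shows "has_total_deriv m I F F'"
  unfolding has_total_deriv_def
proof (intro ballI allI)
  fix x u assume "x \<in> I"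
  with assms show "\<exists>d e. ((\<lambda>t. F t u) has_real_derivative d) (at x) \<and>
     (\<forall>k\<le>m. ((\<lambda>t. F x (u(k := t))) has_real_derivative e k) (at (u k))) \<and>
     F' x u = d + (\<Sum>k\<le>m. u (Suc k) * e k)"
    by (intro exI[of _ "d x u"] exI[of _ "e x u"]) simp
qed

lemma total_deriv_eq:
  assumes "has_total_deriv m I F F'" "x \<in> I"
  shows "total_deriv m F x u = F' x u"
  using assms
proof (rule has_total_derivE)
  fix d e assume de: "((\<lambda>t. F t u) has_real_derivative d) (at x)"
    "\<And>k. k \<le> m \<Longrightarrow> ((\<lambda>t. F x (u(k := t))) has_real_derivative e k) (at (u k))"
    "F' x u = d + (\<Sum>k\<le>m. u (Suc k) * e k)"
  have "(\<Sum>k\<le>m. u (Suc k) * jet_du k F x u) = (\<Sum>k\<le>m. u (Suc k) * e k)"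
    by (intro sum.cong) (simp_all add: jet_du_def DERIV_imp_deriv[OF de(2)])
  then show ?thesis
    by (simp add: total_deriv_def jet_dx_def de(3) DERIV_imp_deriv[OF de(1)])
qed

lemma has_total_deriv_cong:
  assumes "open I" "\<And>x u. x \<in> I \<Longrightarrow> F x u = G x u" "has_total_deriv m I F F'"
  shows "has_total_deriv m I G F'"
  unfolding has_total_deriv_def
proof (intro ballI allI)
  fix x u assume x: "x \<in> I"
  obtain d e where de: "((\<lambda>t. F t u) has_real_derivative d) (at x)"
    "\<forall>k\<le>m. ((\<lambda>t. F x (u(k := t))) has_real_derivative e k) (at (u k))"
    "F' x u = d + (\<Sum>k\<le>m. u (Suc k) * e k)"
    using has_total_derivE[OF assms(3) x, of u] by blast
  have "((\<lambda>t. G t u) has_real_derivative d) (at x)"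
    by (rule has_field_derivative_transform_within_open[OF de(1) assms(1) x assms(2)])
  moreover have "(\<lambda>t. G x (u(k := t))) = (\<lambda>t. F x (u(k := t)))" for k
    using assms(2)[OF x] by auto
  ultimately show "\<exists>d e. ((\<lambda>t. G t u) has_real_derivative d) (at x) \<and>
     (\<forall>k\<le>m. ((\<lambda>t. G x (u(k := t))) has_real_derivative e k) (at (u k))) \<and>
     F' x u = d + (\<Sum>k\<le>m. u (Suc k) * e k)"
    using de(2,3) by (intro exI[of _ d] exI[of _ e]) simp
qed

lemma has_total_deriv_add:
  assumes "has_total_deriv m I F F'" "has_total_deriv m I G G'"
  shows "has_total_deriv m I (\<lambda>x u. F x u + G x u) (\<lambda>x u. F' x u + G' x u)"
  unfolding has_total_deriv_def
proof (intro ballI allI)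
  fix x u assume x: "x \<in> I"
  obtain d e where F: "((\<lambda>t. F t u) has_real_derivative d) (at x)"
    "\<And>k. k \<le> m \<Longrightarrow> ((\<lambda>t. F x (u(k := t))) has_real_derivative e k) (at (u k))"
    "F' x u = d + (\<Sum>k\<le>m. u (Suc k) * e k)"
    using has_total_derivE[OF assms(1) x, of u] by blast
  obtain d' e' where G: "((\<lambda>t. G t u) has_real_derivative d') (at x)"
    "\<And>k. k \<le> m \<Longrightarrow> ((\<lambda>t. G x (u(k := t))) has_real_derivative e' k) (at (u k))"
    "G' x u = d' + (\<Sum>k\<le>m. u (Suc k) * e' k)"
    using has_total_derivE[OF assms(2) x, of u] by blast
  show "\<exists>d e. ((\<lambda>t. F t u + G t u) has_real_derivative d) (at x) \<and>
     (\<forall>k\<le>m. ((\<lambda>t. F x (u(k := t)) + G x (u(k := t))) has_real_derivative e k) (at (u k))) \<and>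
     F' x u + G' x u = d + (\<Sum>k\<le>m. u (Suc k) * e k)"
    by (intro exI[of _ "d + d'"] exI[of _ "\<lambda>k. e k + e' k"] conjI allI impI)
      (simp_all add: F G DERIV_add sum.distrib distrib_left)
qed

lemma has_total_deriv_mult:
  assumes "has_total_deriv m I F F'" "has_total_deriv m I G G'"
  shows "has_total_deriv m I (\<lambda>x u. F x u * G x u) (\<lambda>x u. F' x u * G x u + F x u * G' x u)"
  unfolding has_total_deriv_def
proof (intro ballI allI)
  fix x u assume x: "x \<in> I"
  obtain d e where F: "((\<lambda>t. F t u) has_real_derivative d) (at x)"
    "\<And>k. k \<le> m \<Longrightarrow> ((\<lambda>t. F x (u(k := t))) has_real_derivative e k) (at (u k))"
    "F' x u = d + (\<Sum>k\<le>m. u (Suc k) * e k)"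
    using has_total_derivE[OF assms(1) x, of u] by blast
  obtain d' e' where G: "((\<lambda>t. G t u) has_real_derivative d') (at x)"
    "\<And>k. k \<le> m \<Longrightarrow> ((\<lambda>t. G x (u(k := t))) has_real_derivative e' k) (at (u k))"
    "G' x u = d' + (\<Sum>k\<le>m. u (Suc k) * e' k)"
    using has_total_derivE[OF assms(2) x, of u] by blast
  have upd: "u(k := u k) = u" for k by simp
  show "\<exists>d e. ((\<lambda>t. F t u * G t u) has_real_derivative d) (at x) \<and>
     (\<forall>k\<le>m. ((\<lambda>t. F x (u(k := t)) * G x (u(k := t))) has_real_derivative e k) (at (u k))) \<and>
     F' x u * G x u + F x u * G' x u = d + (\<Sum>k\<le>m. u (Suc k) * e k)"
  proof (intro exI[of _ "d * G x u + d' * F x u"] exI[of _ "\<lambda>k. e k * G x u + e' k * F x u"] conjI allI impI)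
    show "((\<lambda>t. F t u * G t u) has_real_derivative d * G x u + d' * F x u) (at x)"
      by (rule DERIV_mult[OF F(1) G(1)])
    show "((\<lambda>t. F x (u(k := t)) * G x (u(k := t))) has_real_derivative e k * G x u + e' k * F x u) (at (u k))"
      if "k \<le> m" for k
      using DERIV_mult[OF F(2)[OF that] G(2)[OF that]] by (simp add: upd)
    show "F' x u * G x u + F x u * G' x u =
        d * G x u + d' * F x u + (\<Sum>k\<le>m. u (Suc k) * (e k * G x u + e' k * F x u))"
      by (simp add: F(3) G(3) algebra_simps sum.distrib sum_distrib_left)
  qed
qed

lemma has_total_deriv_fun:
  assumes "smooth_on f I"
  shows "has_total_deriv m I (\<lambda>x u. f x) (\<lambda>x u. deriv f x)"
  by (rule has_total_derivI[where e = "\<lambda>_ _ _. 0", OF smooth_on_has_real_derivative[OF assms]]) auto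

lemma has_total_deriv_const: "has_total_deriv m I (\<lambda>x u. c) (\<lambda>x u. 0)"
  by (rule has_total_derivI[where d = "\<lambda>_ _. 0" and e = "\<lambda>_ _ _. 0"]) auto

lemma has_total_deriv_diff:
  assumes "has_total_deriv m I F F'" "has_total_deriv m I G G'"
  shows "has_total_deriv m I (\<lambda>x u. F x u - G x u) (\<lambda>x u. F' x u - G' x u)"
  using has_total_deriv_add[OF assms(1) has_total_deriv_mult[OF has_total_deriv_const assms(2)], of "-1"]
  by simp

lemma has_total_deriv_coord:
  assumes "k \<le> m"
  shows "has_total_deriv m I (\<lambda>x u. u k) (\<lambda>x u. u (Suc k))"
  by (rule has_total_derivI[where d = "\<lambda>_ _. 0" and e = "\<lambda>_ _ j. if j = k then 1 else 0"])
    (use assms in \<open>auto simp: if_distrib cong: if_cong\<close>)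

definition dx :: "(real \<times> real \<Rightarrow> real) \<Rightarrow> real \<times> real \<Rightarrow> real" where
  "dx g p = frechet_derivative g (at p) (1, 0)"

definition dy :: "(real \<times> real \<Rightarrow> real) \<Rightarrow> real \<times> real \<Rightarrow> real" where
  "dy g p = frechet_derivative g (at p) (0, 1)"

lemma smooth_on_dx: "smooth_on g S \<Longrightarrow> smooth_on (dx g) S"
  unfolding dx_def[abs_def] by (rule smooth_on_frechet_derivative)

lemma smooth_on_dy: "smooth_on g S \<Longrightarrow> smooth_on (dy g) S"
  unfolding dy_def[abs_def] by (rule smooth_on_frechet_derivative)

lemma dx_has_real_derivative:
  assumes "smooth_on g S" "(x, y) \<in> S"
  shows "((\<lambda>t. g (t, y)) has_real_derivative dx g (x, y)) (at x)"
proof -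
  let ?L = "frechet_derivative g (at (x, y))"
  have L: "(g has_derivative ?L) (at (x, y))" by (rule smooth_on_has_derivative[OF assms])
  then interpret L: bounded_linear ?L by (rule has_derivative_bounded_linear)
  have "((\<lambda>t. g (t, y)) has_derivative (\<lambda>h. ?L (h, 0))) (at x)"
    by (rule has_derivative_compose[where g = g and f = "\<lambda>t. (t, y)", OF _ L])
      (auto intro!: derivative_eq_intros)
  moreover have "?L (h, 0) = dx g (x, y) * h" for h
    using L.scaleR[of h "(1, 0)"] by (simp add: dx_def mult.commute)
  ultimately show ?thesis by (simp add: has_field_derivative_def)
qed

lemma dy_has_real_derivative:
  assumes "smooth_on g S" "(x, y) \<in> S"
  shows "((\<lambda>t. g (x, t)) has_real_derivative dy g (x, y)) (at y)"
proof -
  let ?L = "frechet_derivative g (at (x, y))"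
  have L: "(g has_derivative ?L) (at (x, y))" by (rule smooth_on_has_derivative[OF assms])
  then interpret L: bounded_linear ?L by (rule has_derivative_bounded_linear)
  have "((\<lambda>t. g (x, t)) has_derivative (\<lambda>h. ?L (0, h))) (at y)"
    by (rule has_derivative_compose[where g = g and f = "\<lambda>t. (x, t)", OF _ L])
      (auto intro!: derivative_eq_intros)
  moreover have "?L (0, h) = dy g (x, y) * h" for h
    using L.scaleR[of h "(0, 1)"] by (simp add: dy_def mult.commute)
  ultimately show ?thesis by (simp add: has_field_derivative_def)
qed

lemma has_total_deriv_point_fun:
  assumes "smooth_on g (I \<times> UNIV)"
  shows "has_total_deriv m I (\<lambda>x u. g (x, u 0)) (\<lambda>x u. dx g (x, u 0) + u 1 * dy g (x, u 0))"
  unfolding has_total_deriv_def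
proof (intro ballI allI)
  fix x u assume x: "x \<in> I"
  show "\<exists>d e. ((\<lambda>t. g (t, u 0)) has_real_derivative d) (at x) \<and>
     (\<forall>k\<le>m. ((\<lambda>t. g (x, (u(k := t)) 0)) has_real_derivative e k) (at (u k))) \<and>
     dx g (x, u 0) + u 1 * dy g (x, u 0) = d + (\<Sum>k\<le>m. u (Suc k) * e k)"
  proof (intro exI[of _ "dx g (x, u 0)"] exI[of _ "\<lambda>k. if k = 0 then dy g (x, u 0) else 0"] conjI allI impI)
    show "((\<lambda>t. g (x, (u(k := t)) 0)) has_real_derivative (if k = 0 then dy g (x, u 0) else 0)) (at (u k))" for k
      using dy_has_real_derivative[OF assms, of x "u 0"] x by auto
  qed (use dx_has_real_derivative[OF assms] x in \<open>auto simp: if_distrib cong: if_cong\<close>)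
qed

lemmas has_total_deriv_intros = has_total_deriv_add has_total_deriv_diff has_total_deriv_mult
  has_total_deriv_const has_total_deriv_coord has_total_deriv_fun has_total_deriv_point_fun

lemma prolong_coeff_Suc_eq:
  assumes "open I" "\<And>x u. x \<in> I \<Longrightarrow> prolong_coeff v k x u = E x u"
    and "has_total_deriv k I E E'" "has_total_deriv 0 I (vf_xi v) X" "x \<in> I"
  shows "prolong_coeff v (Suc k) x u = E' x u - u (Suc k) * X x u"
proof -
  have "has_total_deriv k I (prolong_coeff v k) E'"
    by (rule has_total_deriv_cong[OF assms(1) _ assms(3)]) (simp add: assms(2))
  then show ?thesis
    by (simp add: total_deriv_eq[OF _ \<open>x \<in> I\<close>] assms(4))
qed

text \<open>
Each step is \<open>\<eta>\<^sup>(\<^sup>k\<^sup>+\<^sup>1\<^sup>) = D \<eta>\<^sup>(\<^sup>k\<^sup>) - u\<^sub>k\<^sub>+\<^sub>1 \<xi>'\<close>; since \<open>\<xi>\<close> depends on \<open>x\<close> only, all coefficients stay linear in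
the jet coordinates.
\<close>

lemma affine_prolongation:
  fixes \<xi> \<phi> \<psi> :: "real \<Rightarrow> real"
  assumes I: "open I" and sm: "smooth_on \<xi> I" "smooth_on \<phi> I" "smooth_on \<psi> I"
    and v: "\<forall>x\<in>I. \<forall>y. v (x, y) = (\<xi> x, \<phi> x * y + \<psi> x)"
    and x: "x \<in> I"
  shows "prolong_coeff v 0 x u = \<phi> x * u 0 + \<psi> x" (is "_ = ?e0 x u")
    and "prolong_coeff v 1 x u = deriv \<psi> x + deriv \<phi> x * u 0 + (\<phi> x - deriv \<xi> x) * u 1" (is "_ = ?e1 x u")
    and "prolong_coeff v 2 x u = deriv (deriv \<psi>) x + deriv (deriv \<phi>) x * u 0
      + (2 * deriv \<phi> x - deriv (deriv \<xi>) x) * u 1 + (\<phi> x - 2 * deriv \<xi> x) * u 2" (is "_ = ?e2 x u")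
    and "prolong_coeff v 3 x u = deriv (deriv (deriv \<psi>)) x + deriv (deriv (deriv \<phi>)) x * u 0
      + (3 * deriv (deriv \<phi>) x - deriv (deriv (deriv \<xi>)) x) * u 1
      + (3 * deriv \<phi> x - 3 * deriv (deriv \<xi>) x) * u 2 + (\<phi> x - 3 * deriv \<xi> x) * u 3" (is "_ = ?e3 x u")
    and "prolong_coeff v 4 x u = deriv (deriv (deriv (deriv \<psi>))) x + deriv (deriv (deriv (deriv \<phi>))) x * u 0
      + (4 * deriv (deriv (deriv \<phi>)) x - deriv (deriv (deriv (deriv \<xi>))) x) * u 1
      + (6 * deriv (deriv \<phi>) x - 4 * deriv (deriv (deriv \<xi>)) x) * u 2
      + (4 * deriv \<phi> x - 6 * deriv (deriv \<xi>) x) * u 3 + (\<phi> x - 4 * deriv \<xi> x) * u 4"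
proof -
  note sm' = sm smooth_on_deriv[OF I]
  have X: "has_total_deriv 0 I (vf_xi v) (\<lambda>x u. deriv \<xi> x)"
    by (rule has_total_deriv_cong[OF I _ has_total_deriv_fun[OF sm(1)]]) (simp add: vf_xi_def v)
  note step = prolong_coeff_Suc_eq[OF I _ _ X]
  have e0: "prolong_coeff v 0 x u = ?e0 x u" if "x \<in> I" for x u
    using that by (simp add: vf_eta_def v)
  have e1: "prolong_coeff v (Suc 0) x u = ?e1 x u" if "x \<in> I" for x u
    by (subst step[OF e0 _ that], assumption, (rule has_total_deriv_intros sm' le_refl)+)
      (simp add: algebra_simps)
  have e2: "prolong_coeff v (Suc (Suc 0)) x u = ?e2 x u" if "x \<in> I" for x u
    by (subst step[OF e1 _ that], assumption, (rule has_total_deriv_intros sm' | simp)+)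
      (simp add: algebra_simps eval_nat_numeral)
  have e3: "prolong_coeff v (Suc (Suc (Suc 0))) x u = ?e3 x u" if "x \<in> I" for x u
    by (subst step[OF e2 _ that], assumption, (rule has_total_deriv_intros sm' | simp)+)
      (simp add: algebra_simps eval_nat_numeral)
  have e4: "prolong_coeff v (Suc (Suc (Suc (Suc 0)))) x u = deriv (deriv (deriv (deriv \<psi>))) x + deriv (deriv (deriv (deriv \<phi>))) x * u 0
      + (4 * deriv (deriv (deriv \<phi>)) x - deriv (deriv (deriv (deriv \<xi>))) x) * u 1
      + (6 * deriv (deriv \<phi>) x - 4 * deriv (deriv (deriv \<xi>)) x) * u 2
      + (4 * deriv \<phi> x - 6 * deriv (deriv \<xi>) x) * u 3 + (\<phi> x - 4 * deriv \<xi> x) * u 4" if "x \<in> I" for x u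
    by (subst step[OF e3 _ that], assumption, (rule has_total_deriv_intros sm' | simp)+)
      (simp add: algebra_simps eval_nat_numeral)
  show "prolong_coeff v 0 x u = ?e0 x u" by (rule e0[OF x])
  show "prolong_coeff v 1 x u = ?e1 x u" using e1[OF x] by simp
  show "prolong_coeff v 2 x u = ?e2 x u" using e2[OF x] by (simp add: eval_nat_numeral)
  show "prolong_coeff v 3 x u = ?e3 x u" using e3[OF x] by (simp add: eval_nat_numeral)
  show "prolong_coeff v 4 x u = deriv (deriv (deriv (deriv \<psi>))) x + deriv (deriv (deriv (deriv \<phi>))) x * u 0
      + (4 * deriv (deriv (deriv \<phi>)) x - deriv (deriv (deriv (deriv \<xi>))) x) * u 1
      + (6 * deriv (deriv \<phi>) x - 4 * deriv (deriv (deriv \<xi>)) x) * u 2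
      + (4 * deriv \<phi> x - 6 * deriv (deriv \<xi>) x) * u 3 + (\<phi> x - 4 * deriv \<xi> x) * u 4"
    using e4[OF x] by (simp add: eval_nat_numeral)
qed

section \<open>Determining equations of affine vector fields\<close>

abbreviation (input) linear_jet :: "(real \<Rightarrow> real) \<Rightarrow> (real \<Rightarrow> real) \<Rightarrow> (real \<Rightarrow> real) \<Rightarrow> (real \<Rightarrow> real) \<Rightarrow> jet_fun" where
  "linear_jet c0 c1 c2 c3 \<equiv> \<lambda>x u. u 4 + c3 x * u 3 + c2 x * u 2 + c1 x * u 1 + c0 x * u 0"

lemma prolong_apply_linear:
  assumes "smooth_on c0 I" "smooth_on c1 I" "smooth_on c2 I" "smooth_on c3 I" "x \<in> I"
  shows "prolong_apply 4 v (linear_jet c0 c1 c2 c3) x u =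
    fst (v (x, u 0)) * (deriv c3 x * u 3 + deriv c2 x * u 2 + deriv c1 x * u 1 + deriv c0 x * u 0)
    + prolong_coeff v 4 x u + c3 x * prolong_coeff v 3 x u + c2 x * prolong_coeff v 2 x u
    + c1 x * prolong_coeff v 1 x u + c0 x * prolong_coeff v 0 x u"
proof -
  let ?F = "linear_jet c0 c1 c2 c3"
  note d = smooth_on_has_real_derivative[OF _ \<open>x \<in> I\<close>]
  have "jet_dx ?F x u = deriv c3 x * u 3 + deriv c2 x * u 2 + deriv c1 x * u 1 + deriv c0 x * u 0"
    unfolding jet_dx_def
    by (rule DERIV_imp_deriv) (auto intro!: derivative_eq_intros assms d)
  moreover have "jet_du 0 ?F x u = c0 x" "jet_du 1 ?F x u = c1 x" "jet_du 2 ?F x u = c2 x"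
    "jet_du 3 ?F x u = c3 x" "jet_du 4 ?F x u = 1"
    unfolding jet_du_def by (rule DERIV_imp_deriv, auto intro!: derivative_eq_intros)+
  moreover have "(\<Sum>k\<le>4. h k) = h 4 + h 3 + h 2 + h 1 + h 0" for h :: "nat \<Rightarrow> real"
    by (simp add: eval_nat_numeral)
  ultimately show ?thesis
    by (simp add: prolong_apply_def vf_xi_def algebra_simps)
qed

text \<open>
The coefficients of \<open>u 3\<close>, \<open>u 2\<close>, \<open>u 1\<close>, \<open>u 0\<close> and of the constant monomial in the invariance condition of
\<open>\<xi>(x) d/dx + (\<phi>(x) y + \<psi>(x)) d/dy\<close>, in this order, after \<open>u 4\<close> has been eliminated.
\<close>

definition determining :: "(real \<Rightarrow> real) \<Rightarrow> (real \<Rightarrow> real) \<Rightarrow> (real \<Rightarrow> real) \<Rightarrow> (real \<Rightarrow> real) \<Rightarrow>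
    (real \<Rightarrow> real) \<Rightarrow> (real \<Rightarrow> real) \<Rightarrow> (real \<Rightarrow> real) \<Rightarrow> real \<Rightarrow> bool" where
  "determining c0 c1 c2 c3 \<xi> \<phi> \<psi> x \<longleftrightarrow>
     4 * deriv \<phi> x - 6 * deriv (deriv \<xi>) x + c3 x * deriv \<xi> x + deriv c3 x * \<xi> x = 0 \<and>
     6 * deriv (deriv \<phi>) x - 4 * deriv (deriv (deriv \<xi>)) x
       + 3 * c3 x * (deriv \<phi> x - deriv (deriv \<xi>) x) + 2 * c2 x * deriv \<xi> x + deriv c2 x * \<xi> x = 0 \<and>
     4 * deriv (deriv (deriv \<phi>)) x - deriv (deriv (deriv (deriv \<xi>))) x
       + c3 x * (3 * deriv (deriv \<phi>) x - deriv (deriv (deriv \<xi>)) x)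
       + c2 x * (2 * deriv \<phi> x - deriv (deriv \<xi>) x) + 3 * c1 x * deriv \<xi> x + deriv c1 x * \<xi> x = 0 \<and>
     deriv (deriv (deriv (deriv \<phi>))) x + c3 x * deriv (deriv (deriv \<phi>)) x
       + c2 x * deriv (deriv \<phi>) x + c1 x * deriv \<phi> x + 4 * c0 x * deriv \<xi> x + deriv c0 x * \<xi> x = 0 \<and>
     deriv (deriv (deriv (deriv \<psi>))) x + c3 x * deriv (deriv (deriv \<psi>)) x
       + c2 x * deriv (deriv \<psi>) x + c1 x * deriv \<psi> x + c0 x * \<psi> x = 0"

text \<open>
Applying the prolonged field to the equation reproduces the equation, times \<open>\<phi> - 4 \<xi>'\<close>, up to an affine function
of \<open>u 0, ..., u 3\<close>. On solutions these four coordinates are free, so the affine function has to vanish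
coefficientwise.
\<close>

lemma invariant_iff_determining:
  assumes I: "open I" and c: "smooth_on c0 I" "smooth_on c1 I" "smooth_on c2 I" "smooth_on c3 I"
    and sm: "smooth_on \<xi> I" "smooth_on \<phi> I" "smooth_on \<psi> I"
    and v: "\<forall>x\<in>I. \<forall>y. v (x, y) = (\<xi> x, \<phi> x * y + \<psi> x)"
  shows "infinitesimally_invariant 4 I (linear_jet c0 c1 c2 c3) v \<longleftrightarrow>
    (\<forall>x\<in>I. determining c0 c1 c2 c3 \<xi> \<phi> \<psi> x)"
proof -
  define R0 where "R0 x = deriv (deriv (deriv (deriv \<phi>))) x + c3 x * deriv (deriv (deriv \<phi>)) x
       + c2 x * deriv (deriv \<phi>) x + c1 x * deriv \<phi> x + 4 * c0 x * deriv \<xi> x + deriv c0 x * \<xi> x" for x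
  define R1 where "R1 x = 4 * deriv (deriv (deriv \<phi>)) x - deriv (deriv (deriv (deriv \<xi>))) x
       + c3 x * (3 * deriv (deriv \<phi>) x - deriv (deriv (deriv \<xi>)) x)
       + c2 x * (2 * deriv \<phi> x - deriv (deriv \<xi>) x) + 3 * c1 x * deriv \<xi> x + deriv c1 x * \<xi> x" for x
  define R2 where "R2 x = 6 * deriv (deriv \<phi>) x - 4 * deriv (deriv (deriv \<xi>)) x
       + 3 * c3 x * (deriv \<phi> x - deriv (deriv \<xi>) x) + 2 * c2 x * deriv \<xi> x + deriv c2 x * \<xi> x" for x
  define R3 where "R3 x = 4 * deriv \<phi> x - 6 * deriv (deriv \<xi>) x + c3 x * deriv \<xi> x + deriv c3 x * \<xi> x" for x
  define L where "L x = deriv (deriv (deriv (deriv \<psi>))) x + c3 x * deriv (deriv (deriv \<psi>)) x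
       + c2 x * deriv (deriv \<psi>) x + c1 x * deriv \<psi> x + c0 x * \<psi> x" for x
  have apply_eq: "prolong_apply 4 v (linear_jet c0 c1 c2 c3) x u =
      (\<phi> x - 4 * deriv \<xi> x) * linear_jet c0 c1 c2 c3 x u
      + L x + R0 x * u 0 + R1 x * u 1 + R2 x * u 2 + R3 x * u 3" if x: "x \<in> I" for x u
    unfolding prolong_apply_linear[OF c x] affine_prolongation[OF I sm v x]
    by (simp add: v[rule_format, OF x] R0_def R1_def R2_def R3_def L_def algebra_simps)
  have "(\<forall>u. linear_jet c0 c1 c2 c3 x u = 0 \<longrightarrow> prolong_apply 4 v (linear_jet c0 c1 c2 c3) x u = 0)
    \<longleftrightarrow> R3 x = 0 \<and> R2 x = 0 \<and> R1 x = 0 \<and> R0 x = 0 \<and> L x = 0" (is "?inv \<longleftrightarrow> _") if x: "x \<in> I" for x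
  proof
    assume inv: ?inv
    have eq: "L x + R0 x * y0 + R1 x * y1 + R2 x * y2 + R3 x * y3 = 0" for y0 y1 y2 y3
    proof -
      define u :: "nat \<Rightarrow> real" where "u = (\<lambda>_. 0)(0 := y0, 1 := y1, 2 := y2, 3 := y3,
        4 := - (c3 x * y3 + c2 x * y2 + c1 x * y1 + c0 x * y0))"
      have u: "u 0 = y0" "u 1 = y1" "u 2 = y2" "u 3 = y3"
        "u 4 = - (c3 x * y3 + c2 x * y2 + c1 x * y1 + c0 x * y0)"
        by (simp_all add: u_def)
      have z: "linear_jet c0 c1 c2 c3 x u = 0"
        unfolding u by simp
      from inv[rule_format, OF z] show ?thesis unfolding apply_eq[OF x] z u by simp
    qed
    show "R3 x = 0 \<and> R2 x = 0 \<and> R1 x = 0 \<and> R0 x = 0 \<and> L x = 0"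
      using eq[of 0 0 0 0] eq[of 1 0 0 0] eq[of 0 1 0 0] eq[of 0 0 1 0] eq[of 0 0 0 1] by simp
  next
    assume R: "R3 x = 0 \<and> R2 x = 0 \<and> R1 x = 0 \<and> R0 x = 0 \<and> L x = 0"
    show ?inv
      unfolding apply_eq[OF x] using R by simp
  qed
  then show ?thesis
    unfolding infinitesimally_invariant_def determining_def R0_def R1_def R2_def R3_def L_def by blast
qed

section \<open>Symmetries are affine in the fibre\<close>

text \<open>
Only jets with \<open>u 1 = 0\<close> are tested: for them the part of the condition that is quadratic in \<open>u 2, u 3\<close>
consists of the two monomials \<open>(u 2)\<^sup>2\<close> and \<open>u 2 * u 3\<close>. The coefficients of \<open>\<eta>\<^sup>(\<^sup>1\<^sup>)\<close>, \<open>\<eta>\<^sup>(\<^sup>2\<^sup>)\<close>, \<open>\<eta>\<^sup>(\<^sup>3\<^sup>)\<close> are still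
needed for general \<open>u 1\<close>, because the total derivative also differentiates in \<open>u 1\<close>. Mixed
partial derivatives are kept in the order in which they arise; both those of \<open>\<xi>\<close> in the second conclusion
vanish once \<open>\<xi>\<^sub>y\<close> does.
\<close>

lemma fiber_linearity:
  assumes I: "open I" and c: "smooth_on c0 I" "smooth_on c1 I" "smooth_on c2 I" "smooth_on c3 I"
    and sm: "smooth_on \<xi> (I \<times> UNIV)" "smooth_on \<eta> (I \<times> UNIV)"
    and inv: "infinitesimally_invariant 4 I (linear_jet c0 c1 c2 c3) (\<lambda>p. (\<xi> p, \<eta> p))"
    and x: "x \<in> I"
  shows "dy \<xi> (x, y) = 0"
    and "3 * dy (dy \<eta>) (x, y) - 4 * dy (dx \<xi>) (x, y) - 8 * dx (dy \<xi>) (x, y) = 0"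
proof -
  define v where "v = (\<lambda>p. (\<xi> p, \<eta> p))"
  have open_S: "open (I \<times> (UNIV :: real set))" using I by (simp add: open_Times)
  note smooth = sm smooth_on_dx smooth_on_dy smooth_on_add[OF open_S] smooth_on_minus[OF open_S]
    smooth_on_mult[OF open_S] smooth_on_const
  define a0 where "a0 p = dx (dx \<eta>) p" for p
  define a1 where "a1 p = dy (dx \<eta>) p + dx (dy \<eta>) p - dx (dx \<xi>) p" for p
  define a2 where "a2 p = dy (dy \<eta>) p - dy (dx \<xi>) p - dx (dy \<xi>) p" for p
  define a3 where "a3 p = 0 - dy (dy \<xi>) p" for p
  have sa: "smooth_on a0 (I \<times> UNIV)" "smooth_on a1 (I \<times> UNIV)" "smooth_on a2 (I \<times> UNIV)"
    "smooth_on a3 (I \<times> UNIV)"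
    unfolding a0_def[abs_def] a1_def[abs_def] a2_def[abs_def] a3_def[abs_def]
    by (intro smooth)+
  \<comment> \<open>The coefficients \<open>a0, ..., a3\<close> belong to the powers of \<open>u 1\<close> in \<open>\<eta>\<^sup>(\<^sup>2\<^sup>)\<close>; in \<open>\<eta>\<^sup>(\<^sup>3\<^sup>)\<close>, \<open>b0, ..., b4\<close> belong to these powers and \<open>d0, d1, d2\<close> to their products with \<open>u 2\<close>.\<close>
  define b0 where "b0 p = dx a0 p" for p
  define b1 where "b1 p = dy a0 p + dx a1 p" for p
  define b2 where "b2 p = dy a1 p + dx a2 p" for p
  define b3 where "b3 p = dy a2 p + dx a3 p" for p
  define b4 where "b4 p = dy a3 p" for p
  define d0 where "d0 p = a1 p + dx (dy \<eta>) p - 2 * dx (dx \<xi>) p" for p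
  define d1 where "d1 p = 2 * a2 p + dy (dy \<eta>) p - 2 * dy (dx \<xi>) p - 3 * dx (dy \<xi>) p" for p
  define d2 where "d2 p = 3 * a3 p - 3 * dy (dy \<xi>) p" for p
  have sb: "smooth_on b0 (I \<times> UNIV)" "smooth_on b1 (I \<times> UNIV)" "smooth_on b2 (I \<times> UNIV)"
    "smooth_on b3 (I \<times> UNIV)" "smooth_on b4 (I \<times> UNIV)"
    "smooth_on d0 (I \<times> UNIV)" "smooth_on d1 (I \<times> UNIV)" "smooth_on d2 (I \<times> UNIV)"
    unfolding b0_def[abs_def] b1_def[abs_def] b2_def[abs_def] b3_def[abs_def] b4_def[abs_def]
      d0_def[abs_def] d1_def[abs_def] d2_def[abs_def]
    by (intro smooth sa)+
  have X: "has_total_deriv 0 I (vf_xi v) (\<lambda>x u. dx \<xi> (x, u 0) + u 1 * dy \<xi> (x, u 0))"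
    unfolding vf_xi_def[abs_def] v_def fst_conv by (rule has_total_deriv_point_fun[OF sm(1)])
  note step = prolong_coeff_Suc_eq[OF I _ _ X]
  note rules = has_total_deriv_intros sm smooth_on_dx smooth_on_dy sa sb
  let ?e1 = "\<lambda>x u. dx \<eta> (x, u 0) + (dy \<eta> (x, u 0) - dx \<xi> (x, u 0)) * u 1 - dy \<xi> (x, u 0) * u 1 * u 1"
  let ?e2 = "\<lambda>x u. a0 (x, u 0) + a1 (x, u 0) * u 1 + a2 (x, u 0) * u 1 * u 1 + a3 (x, u 0) * u 1 * u 1 * u 1
    + (dy \<eta> (x, u 0) - 2 * dx \<xi> (x, u 0)) * u 2 - 3 * dy \<xi> (x, u 0) * u 1 * u 2"
  let ?e3 = "\<lambda>x u. b0 (x, u 0) + b1 (x, u 0) * u 1 + b2 (x, u 0) * u 1 * u 1 + b3 (x, u 0) * u 1 * u 1 * u 1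
    + b4 (x, u 0) * u 1 * u 1 * u 1 * u 1
    + d0 (x, u 0) * u 2 + d1 (x, u 0) * u 1 * u 2 + d2 (x, u 0) * u 1 * u 1 * u 2 - 3 * dy \<xi> (x, u 0) * u 2 * u 2
    + (dy \<eta> (x, u 0) - 3 * dx \<xi> (x, u 0)) * u 3 - 4 * dy \<xi> (x, u 0) * u 1 * u 3"
  have e0: "prolong_coeff v 0 x u = \<eta> (x, u 0)" for x u
    by (simp add: vf_eta_def v_def)
  have e1: "prolong_coeff v (Suc 0) x u = ?e1 x u" if "x \<in> I" for x u
    by (subst step[OF e0 _ that], (rule rules | simp)+) (simp add: algebra_simps)
  have e2: "prolong_coeff v (Suc (Suc 0)) x u = ?e2 x u" if "x \<in> I" for x u
    by (subst step[OF e1 _ that], assumption, (rule rules | simp)+)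
      (simp add: a0_def a1_def a2_def a3_def algebra_simps eval_nat_numeral)
  have e3: "prolong_coeff v (Suc (Suc (Suc 0))) x u = ?e3 x u" if "x \<in> I" for x u
    by (subst step[OF e2 _ that], assumption, (rule rules | simp)+)
      (simp add: b0_def b1_def b2_def b3_def b4_def d0_def d1_def d2_def algebra_simps eval_nat_numeral)
  have e4: "prolong_coeff v (Suc (Suc (Suc (Suc 0)))) x u =
      dx b0 (x, u 0) + (b1 (x, u 0) + dx d0 (x, u 0)) * u 2
      + (d0 (x, u 0) + dx (dy \<eta>) (x, u 0) - 3 * dx (dx \<xi>) (x, u 0)) * u 3
      + (d1 (x, u 0) - 3 * dx (dy \<xi>) (x, u 0)) * u 2 * u 2 - 10 * dy \<xi> (x, u 0) * u 2 * u 3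
      + (dy \<eta> (x, u 0) - 4 * dx \<xi> (x, u 0)) * u 4" if "x \<in> I" "u 1 = 0" for x u
    by (subst step[OF e3 _ that(1)], assumption, (rule rules | simp)+)
      (use that(2) in \<open>simp add: algebra_simps eval_nat_numeral\<close>)
  let ?P = "(x, y)"
  \<comment> \<open>Second differences in \<open>s\<close> and \<open>t\<close> isolate the two quadratic coefficients; \<open>k0, k1, k2\<close> collect everything else.\<close>
  have "\<exists>k0 k1 k2. \<forall>s t. k0 + k1 * s + k2 * t
      + (d1 ?P - 3 * dx (dy \<xi>) ?P - 3 * c3 x * dy \<xi> ?P) * s * s - 10 * dy \<xi> ?P * s * t = 0"
  proof (intro exI allI)
    fix s t :: real
    define u :: "nat \<Rightarrow> real" where "u = (\<lambda>_. 0)(0 := y, 2 := s, 3 := t,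
      4 := - (c3 x * t + c2 x * s + c0 x * y))"
    have u: "u 0 = y" "u 1 = 0" "u 2 = s" "u 3 = t" "u 4 = - (c3 x * t + c2 x * s + c0 x * y)"
      by (simp_all add: u_def)
    have z: "linear_jet c0 c1 c2 c3 x u = 0" unfolding u by simp
    have "prolong_apply 4 v (linear_jet c0 c1 c2 c3) x u = 0"
      using inv x z unfolding infinitesimally_invariant_def v_def by blast
    moreover have "prolong_coeff v 1 x u = dx \<eta> ?P"
      using e1[OF x, of u] u by simp
    moreover have "prolong_coeff v 2 x u = a0 ?P + (dy \<eta> ?P - 2 * dx \<xi> ?P) * s"
      using e2[OF x, of u] u by (simp add: eval_nat_numeral)
    moreover have "prolong_coeff v 3 x u = b0 ?P + d0 ?P * s - 3 * dy \<xi> ?P * s * s + (dy \<eta> ?P - 3 * dx \<xi> ?P) * t"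
      using e3[OF x, of u] u by (simp add: eval_nat_numeral)
    moreover have "prolong_coeff v 4 x u = dx b0 ?P + (b1 ?P + dx d0 ?P) * s
      + (d0 ?P + dx (dy \<eta>) ?P - 3 * dx (dx \<xi>) ?P) * t
      + (d1 ?P - 3 * dx (dy \<xi>) ?P) * s * s - 10 * dy \<xi> ?P * s * t
      + (dy \<eta> ?P - 4 * dx \<xi> ?P) * - (c3 x * t + c2 x * s + c0 x * y)"
      using e4[OF x, of u] u by (simp add: eval_nat_numeral)
    ultimately have "\<xi> ?P * (deriv c3 x * t + deriv c2 x * s + deriv c0 x * y)
      + (dx b0 ?P + (b1 ?P + dx d0 ?P) * s
      + (d0 ?P + dx (dy \<eta>) ?P - 3 * dx (dx \<xi>) ?P) * t
      + (d1 ?P - 3 * dx (dy \<xi>) ?P) * s * s - 10 * dy \<xi> ?P * s * t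
      + (dy \<eta> ?P - 4 * dx \<xi> ?P) * - (c3 x * t + c2 x * s + c0 x * y))
      + c3 x * (b0 ?P + d0 ?P * s - 3 * dy \<xi> ?P * s * s + (dy \<eta> ?P - 3 * dx \<xi> ?P) * t)
      + c2 x * (a0 ?P + (dy \<eta> ?P - 2 * dx \<xi> ?P) * s) + c1 x * dx \<eta> ?P + c0 x * \<eta> ?P = 0"
      unfolding prolong_apply_linear[OF c x] e0 u by (simp add: v_def)
    then show "(\<xi> ?P * deriv c0 x * y + dx b0 ?P - (dy \<eta> ?P - 4 * dx \<xi> ?P) * c0 x * y
        + c3 x * b0 ?P + c2 x * a0 ?P + c1 x * dx \<eta> ?P + c0 x * \<eta> ?P)
      + (\<xi> ?P * deriv c2 x + b1 ?P + dx d0 ?P - (dy \<eta> ?P - 4 * dx \<xi> ?P) * c2 x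
        + c3 x * d0 ?P + c2 x * (dy \<eta> ?P - 2 * dx \<xi> ?P)) * s
      + (\<xi> ?P * deriv c3 x + d0 ?P + dx (dy \<eta>) ?P - 3 * dx (dx \<xi>) ?P - (dy \<eta> ?P - 4 * dx \<xi> ?P) * c3 x
        + c3 x * (dy \<eta> ?P - 3 * dx \<xi> ?P)) * t
      + (d1 ?P - 3 * dx (dy \<xi>) ?P - 3 * c3 x * dy \<xi> ?P) * s * s - 10 * dy \<xi> ?P * s * t = 0"
      by (simp add: algebra_simps)
  qed
  then obtain k0 k1 k2 where k: "\<And>s t. k0 + k1 * s + k2 * t
      + (d1 ?P - 3 * dx (dy \<xi>) ?P - 3 * c3 x * dy \<xi> ?P) * s * s - 10 * dy \<xi> ?P * s * t = 0"
    by blast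
  show \<xi>y: "dy \<xi> ?P = 0"
    using k[of 0 0] k[of 1 0] k[of 0 1] k[of 1 1] by simp
  have "d1 ?P - 3 * dx (dy \<xi>) ?P = 0"
    using k[of 0 0] k[of 1 0] k[of "-1" 0] \<xi>y by simp
  then show "3 * dy (dy \<eta>) ?P - 4 * dy (dx \<xi>) ?P - 8 * dx (dy \<xi>) ?P = 0"
    by (simp add: d1_def a2_def)
qed

text \<open>
The components of a field \<open>\<xi>(x) d/dx + (\<phi>(x) y + \<psi>(x)) d/dy\<close>, read off from its values at \<open>y = 0\<close> and \<open>y = 1\<close>
so that they depend linearly on the field.
\<close>

definition xi_part :: "vfield \<Rightarrow> real \<Rightarrow> real" where
  "xi_part v x = fst (v (x, 0))"

definition psi_part :: "vfield \<Rightarrow> real \<Rightarrow> real" where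
  "psi_part v x = snd (v (x, 0))"

definition phi_part :: "vfield \<Rightarrow> real \<Rightarrow> real" where
  "phi_part v x = snd (v (x, 1)) - snd (v (x, 0))"

lemma constant_fiber:
  fixes g :: "real \<times> real \<Rightarrow> real"
  assumes "smooth_on g (I \<times> UNIV)" "x \<in> I" "\<And>t. dy g (x, t) = 0"
  shows "g (x, y) = g (x, z)"
proof -
  have "((\<lambda>t. g (x, t)) has_real_derivative 0) (at t)" for t
    using dy_has_real_derivative[OF assms(1), of x t] assms(2,3) by simp
  then show ?thesis
    using DERIV_isconst_all[of "\<lambda>t. g (x, t)" y z] by blast
qed

section \<open>Elimination in the determining equations\<close>

text \<open>
In the three identities the letters \<open>x, f, a, b, c, d, p\<close> with index \<open>i\<close> stand for the \<open>i\<close>-th derivatives of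
\<open>\<xi>\<close>, \<open>\<phi>\<close>, \<open>c3\<close>, \<open>c2\<close>, \<open>c1\<close>, \<open>c0\<close> and of the coefficient \<open>p\<close> of the third-order equation at one point. The hypotheses on
\<open>f\<^sub>i\<close> and \<open>x\<^sub>i\<close> are the \<open>u 3\<close> equation and the third-order equation for \<open>\<xi>\<close> together with their derivatives.
The first identity shows that the \<open>u 2\<close> equation is this third-order equation; by the other two, the \<open>u 1\<close> and \<open>u 0\<close>
equations are combinations of the two coefficient conditions and their derivatives.
\<close>

lemma eliminate_coeff_u2:
  fixes a0 a1 a2 b0 b1 x0 x1 x2 x3 f1 f2 :: real
  assumes "f1 = (6 * x2 - a0 * x1 - a1 * x0) / 4" "f2 = (6 * x3 - a0 * x2 - 2 * a1 * x1 - a2 * x0) / 4"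
  shows "6 * f2 - 4 * x3 + 3 * a0 * (f1 - x2) + 2 * b0 * x1 + b1 * x0
    = 5 * x3 - (3 * a1 + 3 / 4 * a0 ^ 2 - 2 * b0) * x1 - (3 / 2 * a2 + 3 / 4 * a0 * a1 - b1) * x0"
  unfolding assms by (simp add: field_simps power2_eq_square)

lemma eliminate_coeff_u1:
  fixes a0 a1 a2 a3 b0 b1 b2 c0 c1 x0 x1 x2 x3 x4 f1 f2 f3 :: real
  assumes f: "f1 = (6 * x2 - a0 * x1 - a1 * x0) / 4" "f2 = (6 * x3 - a0 * x2 - 2 * a1 * x1 - a2 * x0) / 4"
    "f3 = (6 * x4 - a0 * x3 - 3 * a1 * x2 - 3 * a2 * x1 - a3 * x0) / 4"
    and x3: "x3 = p0 * x1 + p1 * x0 / 2"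
    and x4: "x4 = p0 * x2 + 3 / 2 * p1 * x1 + p2 * x0 / 2"
    and p: "p0 = (3 * a1 + 3 / 4 * a0 ^ 2 - 2 * b0) / 5" "p1 = (3 * a2 + 3 / 2 * a0 * a1 - 2 * b1) / 5"
      "p2 = (3 * a3 + 3 / 2 * a1 ^ 2 + 3 / 2 * a0 * a2 - 2 * b2) / 5"
  shows "8 * (4 * f3 - x4 + a0 * (3 * f2 - x3) + b0 * (2 * f1 - x2) + 3 * c0 * x1 + c1 * x0)
    = 3 * (8 * c0 - (4 * b0 * a0 - a0 ^ 3 + 8 * b1 - 6 * a0 * a1 - 4 * a2)) * x1
    + (8 * c1 - (4 * (b1 * a0 + b0 * a1) - 3 * a0 ^ 2 * a1 + 8 * b2 - 6 * (a1 ^ 2 + a0 * a2) - 4 * a3)) * x0"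
  unfolding f x4 x3 p by (simp add: field_simps power2_eq_square power3_eq_cube)

lemma eliminate_coeff_u0:
  fixes a0 a1 a2 a3 a4 b0 b1 b2 b3 c0 c1 d0 d1 x0 x1 x2 x3 x4 x5 f1 f2 f3 f4 :: real
  assumes f: "f1 = (6 * x2 - a0 * x1 - a1 * x0) / 4" "f2 = (6 * x3 - a0 * x2 - 2 * a1 * x1 - a2 * x0) / 4"
    "f3 = (6 * x4 - a0 * x3 - 3 * a1 * x2 - 3 * a2 * x1 - a3 * x0) / 4"
    "f4 = (6 * x5 - a0 * x4 - 4 * a1 * x3 - 6 * a2 * x2 - 4 * a3 * x1 - a4 * x0) / 4"
    and x3: "x3 = p0 * x1 + p1 * x0 / 2"
    and x4: "x4 = p0 * x2 + 3 / 2 * p1 * x1 + p2 * x0 / 2"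
    and x5: "x5 = p0 * x3 + 5 / 2 * p1 * x2 + 2 * p2 * x1 + p3 * x0 / 2"
    and p: "p0 = (3 * a1 + 3 / 4 * a0 ^ 2 - 2 * b0) / 5" "p1 = (3 * a2 + 3 / 2 * a0 * a1 - 2 * b1) / 5"
      "p2 = (3 * a3 + 3 / 2 * a1 ^ 2 + 3 / 2 * a0 * a2 - 2 * b2) / 5"
      "p3 = (3 * a4 + 9 / 2 * a1 * a2 + 3 / 2 * a0 * a3 - 2 * b3) / 5"
  shows "1600 * (f4 + a0 * f3 + b0 * f2 + c0 * f1 + 4 * d0 * x1 + d1 * x0)
    = (8 * c0 - (4 * b0 * a0 - a0 ^ 3 + 8 * b1 - 6 * a0 * a1 - 4 * a2)) * (300 * x2 - 50 * a0 * x1 - 50 * a1 * x0)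
    + 4 * (1600 * d0 - (144 * b0 ^ 2 - 11 * a0 ^ 4 + 400 * a0 * b1 - 288 * a0 ^ 2 * a1 - 336 * a1 ^ 2
        - 8 * b0 * (a0 ^ 2 + 4 * a1) + 480 * b2 - 560 * a0 * a2 - 320 * a3)) * x1
    + (1600 * d1 - (288 * b0 * b1 - 44 * a0 ^ 3 * a1 + 400 * (a1 * b1 + a0 * b2) - 288 * (2 * a0 * a1 ^ 2 + a0 ^ 2 * a2)
        - 672 * a1 * a2 - 8 * (b1 * (a0 ^ 2 + 4 * a1) + b0 * (2 * a0 * a1 + 4 * a2)) + 480 * b3
        - 560 * (a1 * a2 + a0 * a3) - 320 * a4)) * x0"
  unfolding f x5 x4 x3 p by (simp add: field_simps power2_eq_square power3_eq_cube power4_eq_xxxx)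

section \<open>The symmetry algebra as a solution space\<close>

locale linear_equation4 =
  fixes I :: "real set" and c0 c1 c2 c3 :: "real \<Rightarrow> real"
  assumes open_I: "open I" and interval_I: "is_interval I"
    and c: "smooth_on c0 I" "smooth_on c1 I" "smooth_on c2 I" "smooth_on c3 I"
begin

abbreviation V :: "vfield set" where
  "V \<equiv> symmetry_algebra 4 I (linear_jet c0 c1 c2 c3)"

lemma open_strip: "open (I \<times> (UNIV :: real set))"
  using open_I by (simp add: open_Times)

lemma symmetryD:
  assumes "v \<in> V"
  shows "smooth_on (xi_part v) I" "smooth_on (phi_part v) I" "smooth_on (psi_part v) I"
    and "\<forall>x\<in>I. \<forall>y. v (x, y) = (xi_part v x, phi_part v x * y + psi_part v x)"
    and "\<forall>x\<in>I. determining c0 c1 c2 c3 (xi_part v) (phi_part v) (psi_part v) x"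
    and "\<And>p. p \<notin> I \<times> UNIV \<Longrightarrow> v p = 0"
proof -
  have smv: "smooth_on v (I \<times> UNIV)" and inv: "infinitesimally_invariant 4 I (linear_jet c0 c1 c2 c3) v"
    and out: "\<And>p. p \<notin> I \<times> UNIV \<Longrightarrow> v p = 0"
    using assms by (auto simp: symmetry_algebra_def)
  define \<xi> \<eta> where "\<xi> = (\<lambda>p. fst (v p))" and "\<eta> = (\<lambda>p. snd (v p))"
  have sm: "smooth_on \<xi> (I \<times> UNIV)" "smooth_on \<eta> (I \<times> UNIV)"
    unfolding \<xi>_def \<eta>_def
    by (intro smooth_on_linear_comp[OF open_strip _ smv] bounded_linear_fst bounded_linear_snd)+
  have v: "v = (\<lambda>p. (\<xi> p, \<eta> p))" by (simp add: \<xi>_def \<eta>_def)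
  note fl = fiber_linearity[OF open_I c sm inv[unfolded v]]
  have \<xi>_const: "\<xi> (x, y) = \<xi> (x, 0)" if "x \<in> I" for x y
    by (rule constant_fiber[OF sm(1) that fl(1)[OF that]])
  have dx\<xi>_const: "dx \<xi> (x, y) = dx \<xi> (x, 0)" if "x \<in> I" for x y
  proof (rule DERIV_unique[OF dx_has_real_derivative[OF sm(1)]])
    show "((\<lambda>t. \<xi> (t, y)) has_real_derivative dx \<xi> (x, 0)) (at x)"
      by (rule has_field_derivative_transform_within_open[OF dx_has_real_derivative[OF sm(1), of x 0] open_I that])
        (simp_all add: that \<xi>_const[of _ y])
  qed (simp_all add: that)
  \<comment> \<open>Both mixed derivatives of \<open>\<xi>\<close> vanish, so \<open>fiber_linearity\<close> leaves only \<open>\<eta>\<^sub>y\<^sub>y = 0\<close>.\<close>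
  have dydx: "dy (dx \<xi>) (x, y) = 0" if "x \<in> I" for x y
  proof -
    have "(\<lambda>t. dx \<xi> (x, t)) = (\<lambda>_. dx \<xi> (x, 0))"
      by (rule ext) (rule dx\<xi>_const[OF that])
    then have "((\<lambda>t. dx \<xi> (x, t)) has_real_derivative 0) (at y)"
      by simp
    with dy_has_real_derivative[OF smooth_on_dx[OF sm(1)], of x y] that show ?thesis
      using DERIV_unique by blast
  qed
  have dxdy: "dx (dy \<xi>) (x, y) = 0" if "x \<in> I" for x y
  proof (rule DERIV_unique[OF dx_has_real_derivative[OF smooth_on_dy[OF sm(1)]]])
    show "((\<lambda>t. dy \<xi> (t, y)) has_real_derivative 0) (at x)"
      by (rule has_field_derivative_transform_within_open[where f = "\<lambda>_. 0", OF DERIV_const open_I that])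
        (simp add: fl(1))
  qed (simp add: that)
  have dydy: "dy (dy \<eta>) (x, y) = 0" if "x \<in> I" for x y
    using fl(2)[OF that, of y] dydx[OF that] dxdy[OF that] by simp
  have dy\<eta>_const: "dy \<eta> (x, y) = dy \<eta> (x, 0)" if "x \<in> I" for x y
    by (rule constant_fiber[OF smooth_on_dy[OF sm(2)] that dydy[OF that]])
  have \<eta>_affine: "\<eta> (x, y) = dy \<eta> (x, 0) * y + \<eta> (x, 0)" if "x \<in> I" for x y
  proof -
    have "((\<lambda>t. \<eta> (x, t) - dy \<eta> (x, 0) * t) has_real_derivative 0) (at t)" for t
      using dy_has_real_derivative[OF sm(2), of x t] that dy\<eta>_const[OF that, of t]
      by (auto intro!: derivative_eq_intros)
    then have "\<eta> (x, y) - dy \<eta> (x, 0) * y = \<eta> (x, 0) - dy \<eta> (x, 0) * 0"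
      using DERIV_isconst_all[of "\<lambda>t. \<eta> (x, t) - dy \<eta> (x, 0) * t" y 0] by blast
    then show ?thesis by simp
  qed
  have lin: "bounded_linear (\<lambda>x::real. (x, 0::real))"
    by (intro bounded_linear_Pair bounded_linear_ident bounded_linear_zero)
  have restrict: "smooth_on (\<lambda>x. g (x, 0)) I" if "smooth_on g (I \<times> UNIV)" for g :: "real \<times> real \<Rightarrow> real"
    by (rule smooth_on_comp_linear[OF open_I lin _ that]) auto
  have phi: "phi_part v x = dy \<eta> (x, 0)" if "x \<in> I" for x
    using \<eta>_affine[OF that, of 1] by (simp add: phi_part_def \<eta>_def)
  show sx: "smooth_on (xi_part v) I"
    using restrict[OF sm(1)] unfolding xi_part_def[abs_def] \<xi>_def .
  show sp: "smooth_on (phi_part v) I"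
    by (rule smooth_on_cong[OF open_I _ restrict[OF smooth_on_dy[OF sm(2)]]]) (simp add: phi)
  show ss: "smooth_on (psi_part v) I"
    using restrict[OF sm(2)] unfolding psi_part_def[abs_def] \<eta>_def .
  show aff: "\<forall>x\<in>I. \<forall>y. v (x, y) = (xi_part v x, phi_part v x * y + psi_part v x)"
  proof (intro ballI allI)
    fix x y assume x: "x \<in> I"
    show "v (x, y) = (xi_part v x, phi_part v x * y + psi_part v x)"
      using \<xi>_const[OF x, of y] \<eta>_affine[OF x, of y] phi[OF x]
      by (simp add: xi_part_def psi_part_def \<xi>_def \<eta>_def prod_eq_iff)
  qed
  show "\<forall>x\<in>I. determining c0 c1 c2 c3 (xi_part v) (phi_part v) (psi_part v) x"
    using inv invariant_iff_determining[OF open_I c sx sp ss aff] by blast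
  show "\<And>p. p \<notin> I \<times> UNIV \<Longrightarrow> v p = 0" by (rule out)
qed

lemma symmetryI:
  assumes sm: "smooth_on \<xi> I" "smooth_on \<phi> I" "smooth_on \<psi> I"
    and v: "\<forall>x\<in>I. \<forall>y. v (x, y) = (\<xi> x, \<phi> x * y + \<psi> x)"
    and out: "\<And>p. p \<notin> I \<times> UNIV \<Longrightarrow> v p = 0"
    and det: "\<forall>x\<in>I. determining c0 c1 c2 c3 \<xi> \<phi> \<psi> x"
  shows "v \<in> V"
proof -
  have lift: "smooth_on (\<lambda>p. f (fst p)) (I \<times> (UNIV :: real set))" if "smooth_on f I" for f :: "real \<Rightarrow> real"
    by (rule smooth_on_comp_linear[OF open_strip bounded_linear_fst _ that]) auto
  have snd: "smooth_on (snd :: real \<times> real \<Rightarrow> real) (I \<times> UNIV)"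
    by (rule smooth_on_bounded_linear[OF open_strip bounded_linear_snd])
  have "smooth_on (\<lambda>p. (\<xi> (fst p), \<phi> (fst p) * snd p + \<psi> (fst p))) (I \<times> (UNIV :: real set))"
    by (intro smooth_on_Pair smooth_on_add smooth_on_mult open_strip lift sm snd)
  then have "smooth_on v (I \<times> UNIV)"
    by (rule smooth_on_cong[OF open_strip, rotated]) (use v in auto)
  then show ?thesis
    using invariant_iff_determining[OF open_I c sm v] det out by (auto simp: symmetry_algebra_def)
qed

section \<open>Reduction to the coefficient conditions\<close>

text \<open>
The coefficient conditions say that the functions \<open>defect1\<close> and \<open>defect0\<close> vanish on \<open>I\<close>.
\<close>

definition defect1 :: "real \<Rightarrow> real" where
  "defect1 x = 8 * c1 x - (4 * c2 x * c3 x - c3 x ^ 3 + 8 * deriv c2 x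
     - 6 * c3 x * deriv c3 x - 4 * deriv (deriv c3) x)"

definition defect0 :: "real \<Rightarrow> real" where
  "defect0 x = 1600 * c0 x - (144 * c2 x ^ 2 - 11 * c3 x ^ 4 + 400 * c3 x * deriv c2 x
     - 288 * c3 x ^ 2 * deriv c3 x - 336 * (deriv c3 x) ^ 2
     - 8 * c2 x * (c3 x ^ 2 + 4 * deriv c3 x) + 480 * deriv (deriv c2) x
     - 560 * c3 x * deriv (deriv c3) x - 320 * deriv (deriv (deriv c3)) x)"

text \<open>
The coefficient \<open>p\<close> in \<open>\<xi>''' = p \<xi>' + p' \<xi> / 2\<close>. This is the equation satisfied by products of two
solutions of \<open>4 z'' = p z\<close>.
\<close>

definition potential :: "real \<Rightarrow> real" where
  "potential x = (3 * deriv c3 x + 3 / 4 * c3 x ^ 2 - 2 * c2 x) / 5"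

lemma derivs:
  assumes "smooth_on f I" "x \<in> I"
  shows "(f has_real_derivative deriv f x) (at x)"
    and "(deriv f has_real_derivative deriv (deriv f) x) (at x)"
    and "(deriv (deriv f) has_real_derivative deriv (deriv (deriv f)) x) (at x)"
    and "(deriv (deriv (deriv f)) has_real_derivative deriv (deriv (deriv (deriv f))) x) (at x)"
    and "(deriv (deriv (deriv (deriv f))) has_real_derivative deriv (deriv (deriv (deriv (deriv f)))) x) (at x)"
  by (intro smooth_on_has_real_derivative[OF _ assms(2)] smooth_on_deriv[OF open_I] assms(1))+

lemma deriv_cong_on:
  assumes "\<And>t. t \<in> I \<Longrightarrow> f t = g t" "x \<in> I" "(g has_real_derivative d) (at x)"
  shows "deriv f x = d"
  using deriv_eqI[OF open_I assms(1,2)] DERIV_imp_deriv[OF assms(3)] by simp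

lemma phi_derivs:
  assumes sm: "smooth_on \<xi> I" "smooth_on \<phi> I"
    and R3: "\<forall>x\<in>I. deriv \<phi> x = (6 * deriv (deriv \<xi>) x - c3 x * deriv \<xi> x - deriv c3 x * \<xi> x) / 4"
    and x: "x \<in> I"
  shows "deriv (deriv \<phi>) x = (6 * deriv (deriv (deriv \<xi>)) x - c3 x * deriv (deriv \<xi>) x
      - 2 * deriv c3 x * deriv \<xi> x - deriv (deriv c3) x * \<xi> x) / 4" (is "_ = ?f2 x")
    and "deriv (deriv (deriv \<phi>)) x = (6 * deriv (deriv (deriv (deriv \<xi>))) x - c3 x * deriv (deriv (deriv \<xi>)) x
      - 3 * deriv c3 x * deriv (deriv \<xi>) x - 3 * deriv (deriv c3) x * deriv \<xi> x
      - deriv (deriv (deriv c3)) x * \<xi> x) / 4" (is "_ = ?f3 x")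
    and "deriv (deriv (deriv (deriv \<phi>))) x = (6 * deriv (deriv (deriv (deriv (deriv \<xi>)))) x
      - c3 x * deriv (deriv (deriv (deriv \<xi>))) x
      - 4 * deriv c3 x * deriv (deriv (deriv \<xi>)) x - 6 * deriv (deriv c3) x * deriv (deriv \<xi>) x
      - 4 * deriv (deriv (deriv c3)) x * deriv \<xi> x - deriv (deriv (deriv (deriv c3))) x * \<xi> x) / 4"
proof -
  note d = derivs[OF sm(1)] derivs[OF c(4)]
  have f2: "deriv (deriv \<phi>) x = ?f2 x" if x: "x \<in> I" for x
    by (rule deriv_cong_on[OF R3[rule_format] x]) (auto intro!: derivative_eq_intros d x simp: field_simps)
  have f3: "deriv (deriv (deriv \<phi>)) x = ?f3 x" if x: "x \<in> I" for x
    by (rule deriv_cong_on[OF f2 x]) (auto intro!: derivative_eq_intros d x simp: field_simps)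
  show "deriv (deriv \<phi>) x = ?f2 x" "deriv (deriv (deriv \<phi>)) x = ?f3 x" by (rule f2[OF x] f3[OF x])+
  show "deriv (deriv (deriv (deriv \<phi>))) x = (6 * deriv (deriv (deriv (deriv (deriv \<xi>)))) x
      - c3 x * deriv (deriv (deriv (deriv \<xi>))) x
      - 4 * deriv c3 x * deriv (deriv (deriv \<xi>)) x - 6 * deriv (deriv c3) x * deriv (deriv \<xi>) x
      - 4 * deriv (deriv (deriv c3)) x * deriv \<xi> x - deriv (deriv (deriv (deriv c3))) x * \<xi> x) / 4"
    by (rule deriv_cong_on[OF f3 x]) (auto intro!: derivative_eq_intros d x simp: field_simps)
qed

lemma potential_derivs:
  assumes x: "x \<in> I"
  shows "deriv potential x = (3 * deriv (deriv c3) x + 3 / 2 * c3 x * deriv c3 x - 2 * deriv c2 x) / 5" (is "_ = ?p1 x")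
    and "deriv (deriv potential) x = (3 * deriv (deriv (deriv c3)) x + 3 / 2 * (deriv c3 x) ^ 2
      + 3 / 2 * c3 x * deriv (deriv c3) x - 2 * deriv (deriv c2) x) / 5" (is "_ = ?p2 x")
    and "deriv (deriv (deriv potential)) x = (3 * deriv (deriv (deriv (deriv c3))) x
      + 9 / 2 * deriv c3 x * deriv (deriv c3) x
      + 3 / 2 * c3 x * deriv (deriv (deriv c3)) x - 2 * deriv (deriv (deriv c2)) x) / 5"
proof -
  note d = derivs[OF c(4)] derivs[OF c(3)]
  have p1: "deriv potential x = ?p1 x" if x: "x \<in> I" for x
    by (rule deriv_cong_on[OF potential_def x])
      (auto intro!: derivative_eq_intros d x simp: field_simps power2_eq_square)
  have p2: "deriv (deriv potential) x = ?p2 x" if x: "x \<in> I" for x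
    by (rule deriv_cong_on[OF p1 x])
      (auto intro!: derivative_eq_intros d x simp: field_simps power2_eq_square)
  show "deriv potential x = ?p1 x" "deriv (deriv potential) x = ?p2 x" by (rule p1[OF x] p2[OF x])+
  show "deriv (deriv (deriv potential)) x = (3 * deriv (deriv (deriv (deriv c3))) x
      + 9 / 2 * deriv c3 x * deriv (deriv c3) x
      + 3 / 2 * c3 x * deriv (deriv (deriv c3)) x - 2 * deriv (deriv (deriv c2)) x) / 5"
    by (rule deriv_cong_on[OF p2 x])
      (auto intro!: derivative_eq_intros d x simp: field_simps power2_eq_square)
qed

lemma smooth_potential: "smooth_on potential I"
  unfolding potential_def[abs_def] power2_eq_square divide_inverse
  by (intro smooth_on_minus smooth_on_add smooth_on_mult smooth_on_const smooth_on_deriv open_I c)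

lemma defect_derivs:
  assumes x: "x \<in> I"
  shows "deriv defect1 x = 8 * deriv c1 x - (4 * (deriv c2 x * c3 x + c2 x * deriv c3 x) - 3 * c3 x ^ 2 * deriv c3 x
      + 8 * deriv (deriv c2) x - 6 * ((deriv c3 x) ^ 2 + c3 x * deriv (deriv c3) x) - 4 * deriv (deriv (deriv c3)) x)"
    and "deriv defect0 x = 1600 * deriv c0 x - (288 * c2 x * deriv c2 x - 44 * c3 x ^ 3 * deriv c3 x
      + 400 * (deriv c3 x * deriv c2 x + c3 x * deriv (deriv c2) x)
      - 288 * (2 * c3 x * (deriv c3 x) ^ 2 + c3 x ^ 2 * deriv (deriv c3) x)
      - 672 * deriv c3 x * deriv (deriv c3) x
      - 8 * (deriv c2 x * (c3 x ^ 2 + 4 * deriv c3 x) + c2 x * (2 * c3 x * deriv c3 x + 4 * deriv (deriv c3) x))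
      + 480 * deriv (deriv (deriv c2)) x
      - 560 * (deriv c3 x * deriv (deriv c3) x + c3 x * deriv (deriv (deriv c3)) x)
      - 320 * deriv (deriv (deriv (deriv c3))) x)"
proof -
  note d = derivs[OF c(4)] derivs[OF c(3)] derivs[OF c(2)] derivs[OF c(1)]
  show "deriv defect1 x = 8 * deriv c1 x - (4 * (deriv c2 x * c3 x + c2 x * deriv c3 x) - 3 * c3 x ^ 2 * deriv c3 x
      + 8 * deriv (deriv c2) x - 6 * ((deriv c3 x) ^ 2 + c3 x * deriv (deriv c3) x) - 4 * deriv (deriv (deriv c3)) x)"
    by (rule deriv_cong_on[OF defect1_def x])
      (auto intro!: derivative_eq_intros d x simp: algebra_simps power2_eq_square)
  show "deriv defect0 x = 1600 * deriv c0 x - (288 * c2 x * deriv c2 x - 44 * c3 x ^ 3 * deriv c3 x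
      + 400 * (deriv c3 x * deriv c2 x + c3 x * deriv (deriv c2) x)
      - 288 * (2 * c3 x * (deriv c3 x) ^ 2 + c3 x ^ 2 * deriv (deriv c3) x)
      - 672 * deriv c3 x * deriv (deriv c3) x
      - 8 * (deriv c2 x * (c3 x ^ 2 + 4 * deriv c3 x) + c2 x * (2 * c3 x * deriv c3 x + 4 * deriv (deriv c3) x))
      + 480 * deriv (deriv (deriv c2)) x
      - 560 * (deriv c3 x * deriv (deriv c3) x + c3 x * deriv (deriv (deriv c3)) x)
      - 320 * deriv (deriv (deriv (deriv c3))) x)"
    by (rule deriv_cong_on[OF defect0_def x])
      (auto intro!: derivative_eq_intros d x simp: algebra_simps power2_eq_square)
qed

text \<open>
The determining equations after the elimination of \<open>\<phi>\<close>. The first two constrain \<open>\<phi>'\<close> and \<open>\<xi>'''\<close>; the next two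
are the obstructions, of order at most two in \<open>\<xi>\<close>.
\<close>

definition reduced :: "(real \<Rightarrow> real) \<Rightarrow> (real \<Rightarrow> real) \<Rightarrow> (real \<Rightarrow> real) \<Rightarrow> real \<Rightarrow> bool" where
  "reduced \<xi> \<phi> \<psi> x \<longleftrightarrow>
     deriv \<phi> x = (6 * deriv (deriv \<xi>) x - c3 x * deriv \<xi> x - deriv c3 x * \<xi> x) / 4 \<and>
     deriv (deriv (deriv \<xi>)) x = potential x * deriv \<xi> x + deriv potential x / 2 * \<xi> x \<and>
     3 * defect1 x * deriv \<xi> x + deriv defect1 x * \<xi> x = 0 \<and>
     defect1 x * (300 * deriv (deriv \<xi>) x - 50 * c3 x * deriv \<xi> x - 50 * deriv c3 x * \<xi> x)
       + 4 * defect0 x * deriv \<xi> x + deriv defect0 x * \<xi> x = 0 \<and>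
     deriv (deriv (deriv (deriv \<psi>))) x + c3 x * deriv (deriv (deriv \<psi>)) x
       + c2 x * deriv (deriv \<psi>) x + c1 x * deriv \<psi> x + c0 x * \<psi> x = 0"

lemma xi_derivs:
  assumes sm: "smooth_on \<xi> I"
    and E: "\<forall>x\<in>I. deriv (deriv (deriv \<xi>)) x = potential x * deriv \<xi> x + deriv potential x / 2 * \<xi> x"
    and x: "x \<in> I"
  shows "deriv (deriv (deriv (deriv \<xi>))) x = potential x * deriv (deriv \<xi>) x
      + 3 / 2 * deriv potential x * deriv \<xi> x + deriv (deriv potential) x * \<xi> x / 2" (is "_ = ?x4 x")
    and "deriv (deriv (deriv (deriv (deriv \<xi>)))) x = potential x * deriv (deriv (deriv \<xi>)) x
      + 5 / 2 * deriv potential x * deriv (deriv \<xi>) x + 2 * deriv (deriv potential) x * deriv \<xi> x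
      + deriv (deriv (deriv potential)) x * \<xi> x / 2"
proof -
  note d = derivs[OF sm] derivs[OF smooth_potential]
  have x4: "deriv (deriv (deriv (deriv \<xi>))) x = ?x4 x" if x: "x \<in> I" for x
    by (rule deriv_cong_on[OF E[rule_format] x]) (auto intro!: derivative_eq_intros d x simp: field_simps)
  show "deriv (deriv (deriv (deriv \<xi>))) x = ?x4 x" by (rule x4[OF x])
  show "deriv (deriv (deriv (deriv (deriv \<xi>)))) x = potential x * deriv (deriv (deriv \<xi>)) x
      + 5 / 2 * deriv potential x * deriv (deriv \<xi>) x + 2 * deriv (deriv potential) x * deriv \<xi> x
      + deriv (deriv (deriv potential)) x * \<xi> x / 2"
    by (rule deriv_cong_on[OF x4 x]) (auto intro!: derivative_eq_intros d x simp: field_simps)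
qed

text \<open>
The equivalence holds on \<open>I\<close> and not pointwise, since the elimination differentiates the equations
for \<open>\<phi>'\<close> and \<open>\<xi>'''\<close>. If one of these two fails somewhere, both sides are false.
\<close>

lemma determining_iff_reduced:
  assumes sm: "smooth_on \<xi> I" "smooth_on \<phi> I"
  shows "(\<forall>x\<in>I. determining c0 c1 c2 c3 \<xi> \<phi> \<psi> x) \<longleftrightarrow> (\<forall>x\<in>I. reduced \<xi> \<phi> \<psi> x)"
proof (cases "\<forall>x\<in>I. deriv \<phi> x = (6 * deriv (deriv \<xi>) x - c3 x * deriv \<xi> x - deriv c3 x * \<xi> x) / 4")
  case True
  then have R3: "\<And>x. x \<in> I \<Longrightarrow> deriv \<phi> x = (6 * deriv (deriv \<xi>) x - c3 x * deriv \<xi> x - deriv c3 x * \<xi> x) / 4"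
    by blast
  note f = phi_derivs[OF sm True]
  have R2: "6 * deriv (deriv \<phi>) x - 4 * deriv (deriv (deriv \<xi>)) x
       + 3 * c3 x * (deriv \<phi> x - deriv (deriv \<xi>) x) + 2 * c2 x * deriv \<xi> x + deriv c2 x * \<xi> x
    = 5 * (deriv (deriv (deriv \<xi>)) x - (potential x * deriv \<xi> x + deriv potential x / 2 * \<xi> x))" if x: "x \<in> I" for x
    unfolding eliminate_coeff_u2[OF R3[OF x] f(1)[OF x]]
    unfolding potential_def potential_derivs(1)[OF x] by (simp add: field_simps)
  show ?thesis
  proof (cases "\<forall>x\<in>I. deriv (deriv (deriv \<xi>)) x = potential x * deriv \<xi> x + deriv potential x / 2 * \<xi> x")
    case True
    then have E: "\<And>x. x \<in> I \<Longrightarrow> deriv (deriv (deriv \<xi>)) x = potential x * deriv \<xi> x + deriv potential x / 2 * \<xi> x"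
      by blast
    have E': "deriv (deriv (deriv \<xi>)) x = potential x * deriv \<xi> x + deriv potential x * \<xi> x / 2" if "x \<in> I" for x
      using E[OF that] by simp
    note g = xi_derivs[OF sm(1) True]
    have R1: "8 * (4 * deriv (deriv (deriv \<phi>)) x - deriv (deriv (deriv (deriv \<xi>))) x
       + c3 x * (3 * deriv (deriv \<phi>) x - deriv (deriv (deriv \<xi>)) x)
       + c2 x * (2 * deriv \<phi> x - deriv (deriv \<xi>) x) + 3 * c1 x * deriv \<xi> x + deriv c1 x * \<xi> x)
      = 3 * defect1 x * deriv \<xi> x + deriv defect1 x * \<xi> x" if x: "x \<in> I" for x
      unfolding eliminate_coeff_u1[OF R3[OF x] f(1,2)[OF x] E'[OF x] g(1)[OF x] potential_def potential_derivs(1,2)[OF x]]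
      unfolding defect1_def defect_derivs(1)[OF x, unfolded defect1_def] by simp
    have R0: "1600 * (deriv (deriv (deriv (deriv \<phi>))) x + c3 x * deriv (deriv (deriv \<phi>)) x
       + c2 x * deriv (deriv \<phi>) x + c1 x * deriv \<phi> x + 4 * c0 x * deriv \<xi> x + deriv c0 x * \<xi> x)
      = defect1 x * (300 * deriv (deriv \<xi>) x - 50 * c3 x * deriv \<xi> x - 50 * deriv c3 x * \<xi> x)
       + 4 * defect0 x * deriv \<xi> x + deriv defect0 x * \<xi> x" if x: "x \<in> I" for x
      unfolding eliminate_coeff_u0[OF R3[OF x] f(1,2,3)[OF x] E'[OF x] g(1,2)[OF x] potential_def potential_derivs[OF x]]
      unfolding defect_derivs(2)[OF x] unfolding defect1_def defect0_def by simp
    have zero_iff: "p = 0 \<longleftrightarrow> q = 0" if "k * p = q" "k \<noteq> 0" for k p q :: real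
      using that by auto
    have "determining c0 c1 c2 c3 \<xi> \<phi> \<psi> x \<longleftrightarrow> reduced \<xi> \<phi> \<psi> x" if x: "x \<in> I" for x
      unfolding determining_def reduced_def R2[OF x] zero_iff[OF R1[OF x], simplified]
        zero_iff[OF R0[OF x], simplified]
      using R3[OF x] E[OF x] by simp
    then show ?thesis by blast
  next
    case False
    then obtain x where x: "x \<in> I"
      "deriv (deriv (deriv \<xi>)) x \<noteq> potential x * deriv \<xi> x + deriv potential x / 2 * \<xi> x" by blast
    have "\<not> determining c0 c1 c2 c3 \<xi> \<phi> \<psi> x"
      unfolding determining_def R2[OF x(1)] using x(2) by simp
    moreover have "\<not> reduced \<xi> \<phi> \<psi> x"
      unfolding reduced_def using x(2) by simp
    ultimately show ?thesis using x(1) by blast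
  qed
next
  case False
  then obtain x where x: "x \<in> I"
    "deriv \<phi> x \<noteq> (6 * deriv (deriv \<xi>) x - c3 x * deriv \<xi> x - deriv c3 x * \<xi> x) / 4" by blast
  have "\<not> determining c0 c1 c2 c3 \<xi> \<phi> \<psi> x"
    unfolding determining_def using x(2) by (simp add: field_simps)
  moreover have "\<not> reduced \<xi> \<phi> \<psi> x"
    unfolding reduced_def using x(2) by simp
  ultimately show ?thesis using x(1) by blast
qed

section \<open>Initial data of symmetries\<close>

lemma deriv_lincomb:
  assumes sm: "smooth_on f I" "smooth_on g I" and x: "x \<in> I"
  shows "deriv (\<lambda>t. a * f t + g t) x = a * deriv f x + deriv g x"
    and "deriv (deriv (\<lambda>t. a * f t + g t)) x = a * deriv (deriv f) x + deriv (deriv g) x"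
    and "deriv (deriv (deriv (\<lambda>t. a * f t + g t))) x = a * deriv (deriv (deriv f)) x + deriv (deriv (deriv g)) x"
    and "deriv (deriv (deriv (deriv (\<lambda>t. a * f t + g t)))) x =
      a * deriv (deriv (deriv (deriv f))) x + deriv (deriv (deriv (deriv g))) x"
proof -
  note d = derivs[OF sm(1)] derivs[OF sm(2)]
  have 1: "deriv (\<lambda>t. a * f t + g t) x = a * deriv f x + deriv g x" if x: "x \<in> I" for x
    by (rule deriv_cong_on[OF refl x]) (auto intro!: derivative_eq_intros d x)
  have 2: "deriv (deriv (\<lambda>t. a * f t + g t)) x = a * deriv (deriv f) x + deriv (deriv g) x" if x: "x \<in> I" for x
    by (rule deriv_cong_on[OF 1 x]) (auto intro!: derivative_eq_intros d x)
  have 3: "deriv (deriv (deriv (\<lambda>t. a * f t + g t))) x = a * deriv (deriv (deriv f)) x + deriv (deriv (deriv g)) x"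
    if x: "x \<in> I" for x
    by (rule deriv_cong_on[OF 2 x]) (auto intro!: derivative_eq_intros d x)
  show "deriv (deriv (deriv (deriv (\<lambda>t. a * f t + g t)))) x =
      a * deriv (deriv (deriv (deriv f))) x + deriv (deriv (deriv (deriv g))) x"
    by (rule deriv_cong_on[OF 3 x]) (auto intro!: derivative_eq_intros d x)
  show "deriv (\<lambda>t. a * f t + g t) x = a * deriv f x + deriv g x"
    "deriv (deriv (\<lambda>t. a * f t + g t)) x = a * deriv (deriv f) x + deriv (deriv g) x"
    "deriv (deriv (deriv (\<lambda>t. a * f t + g t))) x = a * deriv (deriv (deriv f)) x + deriv (deriv (deriv g)) x"
    by (rule 1[OF x] 2[OF x] 3[OF x])+
qed

lemma part_lincomb:
  "xi_part (vf_scale a v + w) = (\<lambda>x. a * xi_part v x + xi_part w x)"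
  "phi_part (vf_scale a v + w) = (\<lambda>x. a * phi_part v x + phi_part w x)"
  "psi_part (vf_scale a v + w) = (\<lambda>x. a * psi_part v x + psi_part w x)"
  by (auto simp: xi_part_def phi_part_def psi_part_def vf_scale_def algebra_simps)

lemma determining_lincomb:
  assumes sm: "smooth_on \<xi> I" "smooth_on \<phi> I" "smooth_on \<psi> I" "smooth_on \<xi>' I" "smooth_on \<phi>' I" "smooth_on \<psi>' I"
    and x: "x \<in> I"
    and det: "determining c0 c1 c2 c3 \<xi> \<phi> \<psi> x" "determining c0 c1 c2 c3 \<xi>' \<phi>' \<psi>' x"
  shows "determining c0 c1 c2 c3 (\<lambda>x. a * \<xi> x + \<xi>' x) (\<lambda>x. a * \<phi> x + \<phi>' x) (\<lambda>x. a * \<psi> x + \<psi>' x) x"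
proof -
  have key: "a * p + q = 0" if "p = 0" "q = 0" for p q :: real
    using that by simp
  note lin = deriv_lincomb[OF sm(1,4) x] deriv_lincomb[OF sm(2,5) x] deriv_lincomb[OF sm(3,6) x]
  note d = det[unfolded determining_def]
  note d1 = d[THEN conjunct1] and d2 = d[THEN conjunct2, THEN conjunct1]
    and d3 = d[THEN conjunct2, THEN conjunct2, THEN conjunct1]
    and d4 = d[THEN conjunct2, THEN conjunct2, THEN conjunct2, THEN conjunct1]
    and d5 = d[THEN conjunct2, THEN conjunct2, THEN conjunct2, THEN conjunct2]
  show ?thesis
    unfolding determining_def lin
    by (intro conjI, rule trans[OF _ key[OF d1]], simp add: algebra_simps,
        rule trans[OF _ key[OF d2]], simp add: algebra_simps,
        rule trans[OF _ key[OF d3]], simp add: algebra_simps,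
        rule trans[OF _ key[OF d4]], simp add: algebra_simps,
        rule trans[OF _ key[OF d5]], simp add: algebra_simps)
qed

lemma V_lincomb:
  assumes "v \<in> V" "w \<in> V"
  shows "vf_scale a v + w \<in> V"
proof (rule symmetryI)
  note v = symmetryD[OF assms(1)] and w = symmetryD[OF assms(2)]
  show "smooth_on (\<lambda>x. a * xi_part v x + xi_part w x) I"
    "smooth_on (\<lambda>x. a * phi_part v x + phi_part w x) I"
    "smooth_on (\<lambda>x. a * psi_part v x + psi_part w x) I"
    by (intro smooth_on_add smooth_on_mult smooth_on_const open_I v w)+
  show "\<forall>x\<in>I. \<forall>y. (vf_scale a v + w) (x, y) =
      (a * xi_part v x + xi_part w x,
       (a * phi_part v x + phi_part w x) * y + (a * psi_part v x + psi_part w x))"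
    using v(4) w(4) by (simp add: vf_scale_def algebra_simps)
  show "(vf_scale a v + w) p = 0" if "p \<notin> I \<times> UNIV" for p
    using v(6)[OF that] w(6)[OF that] by (simp add: vf_scale_def)
  show "\<forall>x\<in>I. determining c0 c1 c2 c3 (\<lambda>x. a * xi_part v x + xi_part w x)
      (\<lambda>x. a * phi_part v x + phi_part w x) (\<lambda>x. a * psi_part v x + psi_part w x) x"
    using determining_lincomb[OF v(1-3) w(1-3)] v(5) w(5) by blast
qed

lemma zero_in_V: "0 \<in> V"
proof (rule symmetryI)
  have d0: "deriv (\<lambda>_. 0 :: real) = (\<lambda>_. 0)" by (rule ext) simp
  show "smooth_on (\<lambda>_. 0 :: real) I" "smooth_on (\<lambda>_. 0 :: real) I" "smooth_on (\<lambda>_. 0 :: real) I"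
    by (rule smooth_on_const)+
  show "\<forall>x\<in>I. determining c0 c1 c2 c3 (\<lambda>_. 0) (\<lambda>_. 0) (\<lambda>_. 0) x"
    by (simp add: determining_def d0)
qed (auto simp: zero_prod_def)

lemma subspace_V: "vf.subspace V"
proof (rule vf.subspaceI)
  show "0 \<in> V" by (rule zero_in_V)
  show "v + w \<in> V" if "v \<in> V" "w \<in> V" for v w
    using V_lincomb[OF that, of 1] by simp
  show "vf_scale a v \<in> V" if "v \<in> V" for a v
    using V_lincomb[OF that zero_in_V, of a] by simp
qed

definition initial_data :: "real \<Rightarrow> vfield \<Rightarrow> real \<times> real \<times> real \<times> real \<times> real \<times> real \<times> real \<times> real" where
  "initial_data x v = (xi_part v x, deriv (xi_part v) x, deriv (deriv (xi_part v)) x, phi_part v x,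
     psi_part v x, deriv (psi_part v) x, deriv (deriv (psi_part v)) x, deriv (deriv (deriv (psi_part v))) x)"

lemma initial_data_lincomb:
  assumes "v \<in> V" "w \<in> V" "x \<in> I"
  shows "initial_data x (vf_scale a v + w) = a *\<^sub>R initial_data x v + initial_data x w"
proof -
  note v = symmetryD[OF assms(1)] and w = symmetryD[OF assms(2)]
  show ?thesis
    unfolding initial_data_def part_lincomb
    by (simp add: deriv_lincomb[OF v(1) w(1) assms(3)] deriv_lincomb[OF v(3) w(3) assms(3)])
qed

lemma symmetry_reduced:
  assumes "v \<in> V" "x \<in> I"
  shows "reduced (xi_part v) (phi_part v) (psi_part v) x"
  using determining_iff_reduced[OF symmetryD(1,2)[OF assms(1)]] symmetryD(5)[OF assms(1)] assms(2) by blast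

lemma linear_ode_xi:
  assumes "x0 \<in> I"
  shows "linear_ode 3 (\<lambda>j. [\<lambda>t. deriv potential t * (1 / 2), potential, \<lambda>_. 0] ! j) I x0"
proof
  fix j :: nat assume "j < 3"
  then have "j = 0 \<or> j = 1 \<or> j = 2" by auto
  moreover have "smooth_on (\<lambda>t. deriv potential t * (1 / 2)) I"
    by (intro smooth_on_mult smooth_on_deriv smooth_potential smooth_on_const open_I)
  ultimately show "smooth_on ([\<lambda>t. deriv potential t * (1 / 2), potential, \<lambda>_. 0] ! j) I"
    using smooth_potential smooth_on_const[of 0 I] by auto
qed (use open_I interval_I assms in auto)

lemma linear_ode_psi:
  assumes "x0 \<in> I"
  shows "linear_ode 4 (\<lambda>j. [\<lambda>t. - 1 * c0 t, \<lambda>t. - 1 * c1 t, \<lambda>t. - 1 * c2 t, \<lambda>t. - 1 * c3 t] ! j) I x0"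
proof
  fix j :: nat assume "j < 4"
  then have "j = 0 \<or> j = 1 \<or> j = 2 \<or> j = 3" by auto
  moreover have "smooth_on (\<lambda>t. - 1 * c0 t) I" "smooth_on (\<lambda>t. - 1 * c1 t) I"
    "smooth_on (\<lambda>t. - 1 * c2 t) I" "smooth_on (\<lambda>t. - 1 * c3 t) I"
    by (intro smooth_on_mult smooth_on_const open_I c)+
  ultimately show "smooth_on ([\<lambda>t. - 1 * c0 t, \<lambda>t. - 1 * c1 t, \<lambda>t. - 1 * c2 t, \<lambda>t. - 1 * c3 t] ! j) I"
    by auto
qed (use open_I interval_I assms in auto)

lemma initial_data_inj:
  assumes "v \<in> V" "x0 \<in> I" "initial_data x0 v = 0"
  shows "v = 0"
proof -
  define \<xi> \<phi> \<psi> where "\<xi> = xi_part v" and "\<phi> = phi_part v" and "\<psi> = psi_part v"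
  note sm = symmetryD(1-3)[OF assms(1), folded \<xi>_def \<phi>_def \<psi>_def]
  note red = symmetry_reduced[OF assms(1), folded \<xi>_def \<phi>_def \<psi>_def, unfolded reduced_def]
  have init: "\<xi> x0 = 0" "deriv \<xi> x0 = 0" "deriv (deriv \<xi>) x0 = 0" "\<phi> x0 = 0" "\<psi> x0 = 0" "deriv \<psi> x0 = 0"
    "deriv (deriv \<psi>) x0 = 0" "deriv (deriv (deriv \<psi>)) x0 = 0"
    using assms(3) by (simp_all add: initial_data_def \<xi>_def \<phi>_def \<psi>_def zero_prod_def)
  have \<xi>0: "\<xi> x = 0" if "x \<in> I" for x
  proof (rule linear_ode.ode_solution_unique[OF linear_ode_xi[OF assms(2)] sm(1) _ _ that])
    fix t assume "t \<in> I"
    from red[OF this]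
    show "(deriv ^^ 3) \<xi> t = (\<Sum>j<3. ([\<lambda>t. deriv potential t * (1 / 2), potential, \<lambda>_. 0] ! j) t * (deriv ^^ j) \<xi> t)"
      by (simp add: eval_nat_numeral)
  next
    fix j :: nat assume "j < 3"
    then have "j = 0 \<or> j = 1 \<or> j = 2" by auto
    then show "(deriv ^^ j) \<xi> x0 = 0" using init by (auto simp: eval_nat_numeral)
  qed
  have \<psi>0: "\<psi> x = 0" if "x \<in> I" for x
  proof (rule linear_ode.ode_solution_unique[OF linear_ode_psi[OF assms(2)] sm(3) _ _ that])
    fix t assume "t \<in> I"
    from red[OF this]
    show "(deriv ^^ 4) \<psi> t = (\<Sum>j<4. ([\<lambda>t. - 1 * c0 t, \<lambda>t. - 1 * c1 t, \<lambda>t. - 1 * c2 t, \<lambda>t. - 1 * c3 t] ! j) t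
        * (deriv ^^ j) \<psi> t)"
      by (simp add: eval_nat_numeral)
  next
    fix j :: nat assume "j < 4"
    then have "j = 0 \<or> j = 1 \<or> j = 2 \<or> j = 3" by auto
    then show "(deriv ^^ j) \<psi> x0 = 0" using init by (auto simp: eval_nat_numeral)
  qed
  have \<xi>1: "deriv \<xi> x = 0" if "x \<in> I" for x
    by (rule deriv_cong_on[OF \<xi>0 that]) auto
  have \<xi>2: "deriv (deriv \<xi>) x = 0" if "x \<in> I" for x
    by (rule deriv_cong_on[OF \<xi>1 that]) auto
  have "(\<phi> has_real_derivative 0) (at x within I)" if "x \<in> I" for x
  proof -
    have "deriv \<phi> x = 0"
      using red[OF that] \<xi>0[OF that] \<xi>1[OF that] \<xi>2[OF that] by simp
    then show ?thesis
      using smooth_on_has_real_derivative[OF sm(2) that] by (auto intro: DERIV_subset)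
  qed
  then obtain k where "\<And>x. x \<in> I \<Longrightarrow> \<phi> x = k"
    using has_field_derivative_zero_constant[of I \<phi>] interval_I is_interval_convex by blast
  with init(4) assms(2) have \<phi>0: "\<phi> x = 0" if "x \<in> I" for x
    using that by metis
  show "v = 0"
  proof
    fix p :: "real \<times> real"
    obtain x y where p: "p = (x, y)" by fastforce
    show "v p = 0 p"
    proof (cases "x \<in> I")
      case True
      with symmetryD(4)[OF assms(1)] \<xi>0 \<phi>0 \<psi>0 show ?thesis
        by (simp add: p \<xi>_def \<phi>_def \<psi>_def zero_prod_def)
    qed (use symmetryD(6)[OF assms(1), of p] in \<open>simp add: p\<close>)
  qed
qed

lemma dim_V_eq_8_iff:
  assumes "x0 \<in> I"
  shows "vf.dim V = 8 \<longleftrightarrow> initial_data x0 ` V = UNIV"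
proof -
  have zero: "initial_data x0 0 = 0"
    using initial_data_lincomb[OF zero_in_V zero_in_V assms, of 1] by simp
  have "vf.dim V = DIM(real \<times> real \<times> real \<times> real \<times> real \<times> real \<times> real \<times> real)
    \<longleftrightarrow> initial_data x0 ` V = UNIV"
  proof (rule dim_eq_iff_image_UNIV[OF vf.vector_space_axioms subspace_V])
    show "initial_data x0 (v + w) = initial_data x0 v + initial_data x0 w" if "v \<in> V" "w \<in> V" for v w
      using initial_data_lincomb[OF that assms, of 1] by simp
    show "initial_data x0 (vf_scale a v) = a *\<^sub>R initial_data x0 v" if "v \<in> V" for a v
      using initial_data_lincomb[OF that zero_in_V assms, of a] zero by simp
    show "v = 0" if "v \<in> V" "initial_data x0 v = 0" for v
      by (rule initial_data_inj[OF that(1) assms that(2)])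
  qed
  then show ?thesis by (simp add: eval_nat_numeral)
qed

text \<open>
Maximal dimension makes every set of initial data available at every point. The data \<open>\<xi> = 0\<close>, \<open>\<xi>' = 1\<close>, \<open>\<xi>'' = 0\<close>
remove the derivatives of the defects from the two obstructions.
\<close>

lemma defects_vanish:
  assumes "vf.dim V = 8" "x \<in> I"
  shows "defect1 x = 0" "defect0 x = 0"
proof -
  have sym: "3 * defect1 x = 0 \<and> defect1 x * (- 50 * c3 x) + 4 * defect0 x = 0" if x: "x \<in> I" for x
  proof -
    have "(0, 1, 0, 0, 0, 0, 0, 0) \<in> initial_data x ` V"
      using dim_V_eq_8_iff[OF x] assms(1) by simp
    then obtain v where v: "v \<in> V" "(0, 1, 0, 0, 0, 0, 0, 0) = initial_data x v"
      by (rule imageE) auto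
    then have "xi_part v x = 0" "deriv (xi_part v) x = 1" "deriv (deriv (xi_part v)) x = 0"
      by (simp_all add: initial_data_def)
    then show ?thesis
      using symmetry_reduced[OF v(1) x] unfolding reduced_def by auto
  qed
  from sym[OF assms(2)] show "defect1 x = 0" "defect0 x = 0" by auto
qed

lemma initial_data_surj:
  assumes E: "\<And>x. x \<in> I \<Longrightarrow> defect1 x = 0" "\<And>x. x \<in> I \<Longrightarrow> defect0 x = 0" and x0: "x0 \<in> I"
  shows "initial_data x0 ` V = UNIV"
proof -
  have "(p0, p1, p2, q, r0, r1, r2, r3) \<in> initial_data x0 ` V" for p0 p1 p2 q r0 r1 r2 r3
  proof -
    obtain \<xi> where \<xi>: "smooth_on \<xi> I"
      "\<And>t. t \<in> I \<Longrightarrow> (deriv ^^ 3) \<xi> t =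
        (\<Sum>j<3. ([\<lambda>t. deriv potential t * (1 / 2), potential, \<lambda>_. 0] ! j) t * (deriv ^^ j) \<xi> t)"
      "\<And>j. j < 3 \<Longrightarrow> (deriv ^^ j) \<xi> x0 = [p0, p1, p2] ! j"
      using linear_ode.ode_solution_exists[OF linear_ode_xi[OF x0], of "\<lambda>j. [p0, p1, p2] ! j"] by blast
    have \<xi>_ode: "deriv (deriv (deriv \<xi>)) t = potential t * deriv \<xi> t + deriv potential t / 2 * \<xi> t" if "t \<in> I" for t
      using \<xi>(2)[OF that] by (simp add: eval_nat_numeral)
    have \<xi>_init: "\<xi> x0 = p0" "deriv \<xi> x0 = p1" "deriv (deriv \<xi>) x0 = p2"
      using \<xi>(3)[of 0] \<xi>(3)[of 1] \<xi>(3)[of 2] by (simp_all add: eval_nat_numeral)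
    obtain \<psi> where \<psi>: "smooth_on \<psi> I"
      "\<And>t. t \<in> I \<Longrightarrow> (deriv ^^ 4) \<psi> t =
        (\<Sum>j<4. ([\<lambda>t. - 1 * c0 t, \<lambda>t. - 1 * c1 t, \<lambda>t. - 1 * c2 t, \<lambda>t. - 1 * c3 t] ! j) t * (deriv ^^ j) \<psi> t)"
      "\<And>j. j < 4 \<Longrightarrow> (deriv ^^ j) \<psi> x0 = [r0, r1, r2, r3] ! j"
      using linear_ode.ode_solution_exists[OF linear_ode_psi[OF x0], of "\<lambda>j. [r0, r1, r2, r3] ! j"] by blast
    have \<psi>_ode: "deriv (deriv (deriv (deriv \<psi>))) t + c3 t * deriv (deriv (deriv \<psi>)) t
        + c2 t * deriv (deriv \<psi>) t + c1 t * deriv \<psi> t + c0 t * \<psi> t = 0" if "t \<in> I" for t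
      using \<psi>(2)[OF that] by (simp add: eval_nat_numeral)
    have \<psi>_init: "\<psi> x0 = r0" "deriv \<psi> x0 = r1" "deriv (deriv \<psi>) x0 = r2" "deriv (deriv (deriv \<psi>)) x0 = r3"
      using \<psi>(3)[of 0] \<psi>(3)[of 1] \<psi>(3)[of 2] \<psi>(3)[of 3] by (simp_all add: eval_nat_numeral)
    \<comment> \<open>Integrating \<open>4 \<phi>' = 6 \<xi>'' - (c3 \<xi>)'\<close>; the constant is chosen to give the value \<open>q\<close> at \<open>x0\<close>.\<close>
    define \<phi> where "\<phi> x = 3 / 2 * deriv \<xi> x - 1 / 4 * (c3 x * \<xi> x) + (q - 3 / 2 * p1 + 1 / 4 * (c3 x0 * p0))" for x
    have \<phi>: "smooth_on \<phi> I"
      unfolding \<phi>_def[abs_def]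
      by (intro smooth_on_add smooth_on_minus smooth_on_mult smooth_on_const smooth_on_deriv open_I c \<xi>(1))
    have \<phi>': "deriv \<phi> x = (6 * deriv (deriv \<xi>) x - c3 x * deriv \<xi> x - deriv c3 x * \<xi> x) / 4" if x: "x \<in> I" for x
      by (rule deriv_cong_on[OF \<phi>_def x])
        (auto intro!: derivative_eq_intros derivs[OF \<xi>(1) x] derivs[OF c(4) x] simp: field_simps)
    have E': "deriv defect1 x = 0" "deriv defect0 x = 0" if "x \<in> I" for x
      by (rule deriv_cong_on[OF E(1) that] deriv_cong_on[OF E(2) that], auto)+
    have "\<forall>x\<in>I. reduced \<xi> \<phi> \<psi> x"
      unfolding reduced_def using \<phi>' \<xi>_ode \<psi>_ode E E' by simp
    then have det: "\<forall>x\<in>I. determining c0 c1 c2 c3 \<xi> \<phi> \<psi> x"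
      using determining_iff_reduced[OF \<xi>(1) \<phi>] by blast
    define v :: vfield where "v p = (if fst p \<in> I then (\<xi> (fst p), \<phi> (fst p) * snd p + \<psi> (fst p)) else 0)" for p
    have "v \<in> V"
      by (rule symmetryI[OF \<xi>(1) \<phi> \<psi>(1) _ _ det]) (auto simp: v_def)
    have parts: "xi_part v x = \<xi> x" "phi_part v x = \<phi> x" "psi_part v x = \<psi> x" if "x \<in> I" for x
      using that by (simp_all add: xi_part_def phi_part_def psi_part_def v_def)
    have d\<xi>: "deriv (xi_part v) x = deriv \<xi> x" if "x \<in> I" for x
      by (rule deriv_eqI[OF open_I parts(1) that])
    have d\<xi>2: "deriv (deriv (xi_part v)) x = deriv (deriv \<xi>) x" if "x \<in> I" for x
      by (rule deriv_eqI[OF open_I d\<xi> that])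
    have d\<psi>: "deriv (psi_part v) x = deriv \<psi> x" if "x \<in> I" for x
      by (rule deriv_eqI[OF open_I parts(3) that])
    have d\<psi>2: "deriv (deriv (psi_part v)) x = deriv (deriv \<psi>) x" if "x \<in> I" for x
      by (rule deriv_eqI[OF open_I d\<psi> that])
    have d\<psi>3: "deriv (deriv (deriv (psi_part v))) x = deriv (deriv (deriv \<psi>)) x" if "x \<in> I" for x
      by (rule deriv_eqI[OF open_I d\<psi>2 that])
    have "\<phi> x0 = q" by (simp add: \<phi>_def \<xi>_init)
    then have "initial_data x0 v = (p0, p1, p2, q, r0, r1, r2, r3)"
      unfolding initial_data_def
      by (simp only: parts[OF x0] d\<xi>[OF x0] d\<xi>2[OF x0] d\<psi>[OF x0] d\<psi>2[OF x0] d\<psi>3[OF x0] \<xi>_init \<psi>_init)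
    with imageI[OF \<open>v \<in> V\<close>, of "initial_data x0"] show ?thesis by simp
  qed
  then show ?thesis by auto
qed

end

section \<open>Maximal symmetry algebras of fourth-order equations\<close>

theorem mainTheorem6:
  fixes I :: "real set" and c0 c1 c2 c3 :: "real \<Rightarrow> real"
  assumes "open I" and "is_interval I" and "I \<noteq> {}"
    and "smooth_on c0 I" and "smooth_on c1 I" and "smooth_on c2 I" and "smooth_on c3 I"
  shows "has_maximal_symmetry_algebra 4 I
           (\<lambda>x u. u 4 + c3 x * u 3 + c2 x * u 2 + c1 x * u 1 + c0 x * u 0)
     \<longleftrightarrow> (\<forall>x\<in>I.
           8 * c1 x = 4 * c2 x * c3 x - c3 x ^ 3 + 8 * deriv c2 x
             - 6 * c3 x * deriv c3 x - 4 * (deriv ^^ 2) c3 x \<and>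
           1600 * c0 x = 144 * c2 x ^ 2 - 11 * c3 x ^ 4 + 400 * c3 x * deriv c2 x
             - 288 * c3 x ^ 2 * deriv c3 x - 336 * (deriv c3 x) ^ 2
             - 8 * c2 x * (c3 x ^ 2 + 4 * deriv c3 x) + 480 * (deriv ^^ 2) c2 x
             - 560 * c3 x * (deriv ^^ 2) c3 x - 320 * (deriv ^^ 3) c3 x)"
    (is "_ \<longleftrightarrow> (\<forall>x\<in>I. ?C1 x \<and> ?C0 x)")
proof -
  interpret linear_equation4 I c0 c1 c2 c3
    by unfold_locales (use assms in auto)
  obtain x0 where x0: "x0 \<in> I" using assms(3) by blast
  have pow: "(deriv ^^ 2) f = deriv (deriv f)" "(deriv ^^ 3) f = deriv (deriv (deriv f))" for f :: "real \<Rightarrow> real"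
    by (simp_all add: eval_nat_numeral)
  have C: "?C1 x \<longleftrightarrow> defect1 x = 0" "?C0 x \<longleftrightarrow> defect0 x = 0" for x
    unfolding defect1_def defect0_def pow by auto
  have "vf.dim V = 8 \<longleftrightarrow> (\<forall>x\<in>I. defect1 x = 0 \<and> defect0 x = 0)"
    using defects_vanish initial_data_surj[OF _ _ x0] dim_V_eq_8_iff[OF x0] by blast
  then show ?thesis
    unfolding has_maximal_symmetry_algebra_def C by simp
qed

end
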